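(* Let $\beta\in[0,\infty)$ and let $R\subseteq\Lambda$ be star-connected and plaquette-connected with $|R|\ge2$. Then $$\ker(\mathcal L^{(\beta)}_R)=\big(1_R\otimes\mathcal B(\mathcal H_{\Lambda\setminus R})\big)\cap\{A_s,B_p\;:\;s\in\mathcal S_R,\ p\in\mathcal P_R\}'.$$
   Context: Model: Let $G$ be a finite Abelian group with identity $1$, write $\bar g=g^{-1}$, and let $\hat G$ be its character group (homomorphisms $G\to U(1)$ under pointwise multiplication), with $\bar\chi$ the complex-conjugate character. For $N\ge2$, $\Lambda=\Lambda_N$ is the set of edges of the square lattice on the torus $\mathbb Z_N\times\mathbb Z_N$; horizontal edges are oriented to the left, vertical edges downward. Each edge $e$ carries $\mathcal H_e=\ell^2(G)$ with orthonormal basis $\{|g\rangle\}_{g\in G}$; for $V\subseteq\Lambda$, $\mathcal H_V=\bigotimes_{e\in V}\mathcal H_e$ and $\mathcal B(\mathcal H_V)$ is identified with $\mathcal B(\mathcal H_V)\otimes 1_{\Lambda\setminus V}\subseteq\mathcal B(\mathcal H_\Lambda)$. On $\ell^2(G)$ let $L^g=\sum_{h}|gh\rangle\langle h|$ and $M^\chi=\sum_g\chi(g)|g\rangle\langle g|$; $L^g_e,M^\chi_e$ act on edge $e$. A star $s$ is a vertex; $ds$ is the set of its four incident edges and $d_+s$ (resp. $d_-s$) those oriented away from (resp. towards) the vertex. A plaquette $p$ is a face; $\partial p$ is the set of its four boundary edges and $\partial_+p$ (resp. $\partial_-p$) those oriented counterclockwise (resp. clockwise). Set $A_s(g)=\prod_{e\in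 d_+s}L^g_e\prod_{e\in d_-s}L^{\bar g}_e$, $B_p(\chi)=\prod_{e\in\partial_+p}M^\chi_e\prod_{e\in\partial_-p}M^{\bar\chi}_e$, $A_s=\frac1{|G|}\sum_gA_s(g)$, $B_p=\frac1{|G|}\sum_\chi B_p(\chi)$. For $V\subseteq\Lambda$, $\mathcal S_V$ is the set of stars with $ds\cap V\neq\emptyset$, $\mathcal P_V$ the set of plaquettes with $\partial p\cap V\ne\emptyset$, and $H_V=-\sum_{s\in\mathcal S_V}A_s-\sum_{p\in\mathcal P_V}B_p$. Connectivity: $R\subseteq\Lambda$ is star-connected if for all $e,e'\in R$ there is a sequence $e=e_0,s_1,e_1,\dots,s_n,e_n=e'$ with $e_i\in R$ and $e_{i-1},e_i\in ds_i$; plaquette-connected is defined analogously with plaquettes $p_i$ and $e_{i-1},e_i\in\partial p_i$. Davies dynamics: For each edge $e$ there is a finite set $\mathcal S_e=\{S_{e,i}:i\in I\}\subset\mathcal B(\mathcal H_e)$ of bare jump operators that is closed under adjoints and whose commutant in $\mathcal B(\mathcal H_e)$ is $\mathbb C1$. Let $P_\lambda$ be the spectral projections of $H_\Lambda$, $\Omega$ the set of differences of eigenvalues of $H_\Lambda$, and $Q(\omega)=\sum_{\lambda-\lambda'=\omega}P_\lambda QP_{\lambda'}$ for $Q\in\mathcal B(\mathcal H_\Lambda)$. Rates $h^{(\beta)}_{e,i}(\omega)>0$ satisfy $h^{(\beta)}_{e,i}(-\omega)=h^{(\beta)}_{e,i}(\omega)e^{-\beta\omega}$. For $V\subseteq\Lambda$,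 $\mathcal L^{(\beta)}_V=\sum_{e\in V}\mathcal D_e$ with $\mathcal D_e(O)=\sum_{i,\omega}h^{(\beta)}_{e,i}(\omega)\big(S_{e,i}(\omega)^\dagger OS_{e,i}(\omega)-\tfrac12\{S_{e,i}(\omega)^\dagger S_{e,i}(\omega),O\}\big)$. *)

theory Defs
  imports Complex_Main "HOL-Library.Function_Algebras"
begin

section \<open>Lattice geometry of the torus Z_N x Z_N\<close>

text \<open>Vertices are pairs (x,y) with x,y < N (x to the right, y upward).
 Edge (x,y,True) is the horizontal edge between (x,y) and ((x+1) mod N, y), oriented to
 the left, i.e. from tail ((x+1) mod N, y) to head (x,y).
 Edge (x,y,False) is the vertical edge between (x,y) and (x,(y+1) mod N), oriented
 downward, i.e. from tail (x,(y+1) mod N) to head (x,y).\<close>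

type_synonym vertex = "nat \<times> nat"
type_synonym edge = "nat \<times> nat \<times> bool"

definition vertices :: "nat \<Rightarrow> vertex set" where
  "vertices N = {(x,y). x < N \<and> y < N}"

definition lattice :: "nat \<Rightarrow> edge set" where
  "lattice N = {(x,y,d). x < N \<and> y < N}"

fun tail :: "nat \<Rightarrow> edge \<Rightarrow> vertex" where
  "tail N (x,y,True) = ((x+1) mod N, y)"
| "tail N (x,y,False) = (x, (y+1) mod N)"

fun head :: "nat \<Rightarrow> edge \<Rightarrow> vertex" where
  "head N (x,y,d) = (x,y)"

text \<open>Stars: d_+ s (edges oriented away from s), d_- s (towards s), ds.\<close>
definition dplus :: "nat \<Rightarrow> vertex \<Rightarrow> edge set" where
  "dplus N s = {e \<in> lattice N. tail N e = s}"
definition dminus :: "nat \<Rightarrow> vertex \<Rightarrow> edge set" where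
  "dminus N s = {e \<in> lattice N. head N e = s}"
definition dstar :: "nat \<Rightarrow> vertex \<Rightarrow> edge set" where
  "dstar N s = dplus N s \<union> dminus N s"

text \<open>Plaquettes are labelled by their lower-left corner (a,b); corners (a,b),(a+1,b),
 (a+1,b+1),(a,b+1) (mod N).  Counterclockwise traversal goes right along the bottom,
 up the right side, left along the top, down the left side.  With the orientation
 conventions above, the top and left edges are oriented counterclockwise and the
 bottom and right edges clockwise.\<close>
definition pplus :: "nat \<Rightarrow> vertex \<Rightarrow> edge set" where
  "pplus N p = (case p of (a,b) \<Rightarrow> {(a, (b+1) mod N, True), (a, b, False)})"
definition pminus :: "nat \<Rightarrow> vertex \<Rightarrow> edge set" where
  "pminus N p = (case p of (a,b) \<Rightarrow> {(a, b, True), ((a+1) mod N, b, False)})"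
definition pbound :: "nat \<Rightarrow> vertex \<Rightarrow> edge set" where
  "pbound N p = pplus N p \<union> pminus N p"

definition stars_of :: "nat \<Rightarrow> edge set \<Rightarrow> vertex set" where
  "stars_of N V = {s \<in> vertices N. dstar N s \<inter> V \<noteq> {}}"
definition plaqs_of :: "nat \<Rightarrow> edge set \<Rightarrow> vertex set" where
  "plaqs_of N V = {p \<in> vertices N. pbound N p \<inter> V \<noteq> {}}"

text \<open>Connectivity: one step of the chain e_{i-1}, s_i, e_i (resp. p_i).\<close>
definition star_step :: "nat \<Rightarrow> edge set \<Rightarrow> (edge \<times> edge) set" where
  "star_step N R = {(e,e'). e \<in> R \<and> e' \<in> R \<and>
      (\<exists>s \<in> vertices N. e \<in> dstar N s \<and> e' \<in> dstar N s)}"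
definition plaq_step :: "nat \<Rightarrow> edge set \<Rightarrow> (edge \<times> edge) set" where
  "plaq_step N R = {(e,e'). e \<in> R \<and> e' \<in> R \<and>
      (\<exists>p \<in> vertices N. e \<in> pbound N p \<and> e' \<in> pbound N p)}"

definition star_connected :: "nat \<Rightarrow> edge set \<Rightarrow> bool" where
  "star_connected N R \<longleftrightarrow> (\<forall>e\<in>R. \<forall>e'\<in>R. (e,e') \<in> (star_step N R)\<^sup>*)"
definition plaq_connected :: "nat \<Rightarrow> edge set \<Rightarrow> bool" where
  "plaq_connected N R \<longleftrightarrow> (\<forall>e\<in>R. \<forall>e'\<in>R. (e,e') \<in> (plaq_step N R)\<^sup>*)"

section \<open>Single-edge operators on l^2(G) (matrices indexed by G)\<close>

text \<open>The finite Abelian group G is written additively: g+h for gh, -g for g^{-1}, 0 for 1.\<close>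

type_synonym 'g sop = "'g \<Rightarrow> 'g \<Rightarrow> complex"

definition is_character :: "('g::ab_group_add \<Rightarrow> complex) \<Rightarrow> bool" where
  "is_character \<chi> \<longleftrightarrow> (\<forall>g h. \<chi> (g + h) = \<chi> g * \<chi> h) \<and> (\<forall>g. norm (\<chi> g) = 1)"

definition characters :: "('g::ab_group_add \<Rightarrow> complex) set" where
  "characters = {\<chi>. is_character \<chi>}"

definition Lop :: "'g::ab_group_add \<Rightarrow> 'g sop" where
  "Lop g = (\<lambda>a b. if a = g + b then 1 else 0)"

definition Mop :: "('g \<Rightarrow> complex) \<Rightarrow> 'g sop" where
  "Mop \<chi> = (\<lambda>a b. if a = b then \<chi> a else 0)"

definition smult_site :: "'g::finite sop \<Rightarrow> 'g sop \<Rightarrow> 'g sop" where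
  "smult_site A B = (\<lambda>a b. \<Sum>c\<in>UNIV. A a c * B c b)"

definition sadj :: "'g sop \<Rightarrow> 'g sop" where
  "sadj A = (\<lambda>a b. cnj (A b a))"

definition sid :: "'g sop" where
  "sid = (\<lambda>a b. if a = b then 1 else 0)"

section \<open>Operators on H_Lambda (matrices indexed by configurations)\<close>

text \<open>A basis vector of H_Lambda is a configuration c : edge => G, with c e = 0 off the lattice.\<close>

type_synonym 'g conf = "edge \<Rightarrow> 'g"
type_synonym 'g gop = "'g conf \<Rightarrow> 'g conf \<Rightarrow> complex"

definition confs :: "nat \<Rightarrow> ('g::zero) conf set" where
  "confs N = {c. \<forall>e. e \<notin> lattice N \<longrightarrow> c e = 0}"

text \<open>B(H_Lambda): matrices vanishing outside confs N.\<close>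
definition ops :: "nat \<Rightarrow> ('g::zero) gop set" where
  "ops N = {Q. \<forall>c c'. c \<notin> confs N \<or> c' \<notin> confs N \<longrightarrow> Q c c' = 0}"

definition mm :: "nat \<Rightarrow> ('g::zero) gop \<Rightarrow> 'g gop \<Rightarrow> 'g gop" where
  "mm N A B = (\<lambda>c c'. \<Sum>d\<in>confs N. A c d * B d c')"

definition mv :: "nat \<Rightarrow> ('g::zero) gop \<Rightarrow> ('g conf \<Rightarrow> complex) \<Rightarrow> ('g conf \<Rightarrow> complex)" where
  "mv N A v = (\<lambda>c. \<Sum>d\<in>confs N. A c d * v d)"

definition adj :: "('g::zero) gop \<Rightarrow> 'g gop" where
  "adj A = (\<lambda>c c'. cnj (A c' c))"

definition scal :: "complex \<Rightarrow> ('g::zero) gop \<Rightarrow> 'g gop" where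
  "scal k A = (\<lambda>c c'. k * A c c')"

text \<open>Tensor product of the single-edge operators F e (e in V) with the identity on Lambda - V.\<close>
definition tensor :: "nat \<Rightarrow> edge set \<Rightarrow> (edge \<Rightarrow> ('g::zero) sop) \<Rightarrow> 'g gop" where
  "tensor N V F = (\<lambda>c c'. if c \<in> confs N \<and> c' \<in> confs N \<and> (\<forall>e \<in> lattice N - V. c e = c' e)
                          then (\<Prod>e\<in>V. F e (c e) (c' e)) else 0)"

text \<open>Single-edge operator X acting on edge e, i.e. X_e = X (x) 1.\<close>
definition at_edge :: "nat \<Rightarrow> edge \<Rightarrow> ('g::zero) sop \<Rightarrow> 'g gop" where
  "at_edge N e X = tensor N {e} (\<lambda>_. X)"

text \<open>1_R (x) B(H_{Lambda - R}).\<close>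
definition id_tensor :: "nat \<Rightarrow> edge set \<Rightarrow> ('g::zero) gop set" where
  "id_tensor N R = {Q \<in> ops N. \<exists>X :: 'g gop. \<forall>c\<in>confs N. \<forall>c'\<in>confs N.
      Q c c' = (if (\<forall>e\<in>R. c e = c' e)
                then X (\<lambda>e. if e \<in> R then 0 else c e) (\<lambda>e. if e \<in> R then 0 else c' e)
                else 0)}"

section \<open>Quantum double Hamiltonian\<close>

definition Astar_g :: "nat \<Rightarrow> vertex \<Rightarrow> 'g::ab_group_add \<Rightarrow> 'g gop" where
  "Astar_g N s g = tensor N (dstar N s) (\<lambda>e. if e \<in> dplus N s then Lop g else Lop (- g))"

definition Bplaq_chi :: "nat \<Rightarrow> vertex \<Rightarrow> ('g::ab_group_add \<Rightarrow> complex) \<Rightarrow> 'g gop" where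
  "Bplaq_chi N p \<chi> = tensor N (pbound N p)
       (\<lambda>e. if e \<in> pplus N p then Mop \<chi> else Mop (\<lambda>g. cnj (\<chi> g)))"

definition Astar :: "nat \<Rightarrow> vertex \<Rightarrow> ('g::{finite,ab_group_add}) gop" where
  "Astar N s = scal (1 / of_nat (card (UNIV :: 'g set))) (\<Sum>g\<in>UNIV. Astar_g N s g)"

definition Bplaq :: "nat \<Rightarrow> vertex \<Rightarrow> ('g::{finite,ab_group_add}) gop" where
  "Bplaq N p = scal (1 / of_nat (card (UNIV :: 'g set))) (\<Sum>\<chi>\<in>characters. Bplaq_chi N p \<chi>)"

definition Ham :: "nat \<Rightarrow> edge set \<Rightarrow> ('g::{finite,ab_group_add}) gop" where
  "Ham N V = - (\<Sum>s\<in>stars_of N V. Astar N s) - (\<Sum>p\<in>plaqs_of N V. Bplaq N p)"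

section \<open>Spectral decomposition and Davies generator\<close>

definition eigvals :: "nat \<Rightarrow> ('g::zero) gop \<Rightarrow> real set" where
  "eigvals N H = {lam. \<exists>v. (\<forall>c. c \<notin> confs N \<longrightarrow> v c = 0) \<and> v \<noteq> (\<lambda>_. 0) \<and>
                         mv N H v = (\<lambda>c. of_real lam * v c)}"

text \<open>Spectral projection P_lambda: the orthogonal projection onto the lambda-eigenspace.\<close>
definition spec_proj :: "nat \<Rightarrow> ('g::zero) gop \<Rightarrow> real \<Rightarrow> 'g gop" where
  "spec_proj N H lam = (THE P. P \<in> ops N \<and> adj P = P \<and> mm N P P = P \<and>
      (\<forall>v. (\<forall>c. c \<notin> confs N \<longrightarrow> v c = 0) \<longrightarrow>
          (mv N P v = v \<longleftrightarrow> mv N H v = (\<lambda>c. of_real lam * v c))))"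

definition bohr :: "nat \<Rightarrow> ('g::zero) gop \<Rightarrow> real set" where
  "bohr N H = {lam - mu | lam mu. lam \<in> eigvals N H \<and> mu \<in> eigvals N H}"

text \<open>Q(omega) = sum over lambda - lambda' = omega of P_lambda Q P_lambda'.\<close>
definition freq :: "nat \<Rightarrow> ('g::zero) gop \<Rightarrow> 'g gop \<Rightarrow> real \<Rightarrow> 'g gop" where
  "freq N H Q \<omega> = (\<Sum>(lam,mu)\<in>{(lam,mu) \<in> eigvals N H \<times> eigvals N H. lam - mu = \<omega>}.
       mm N (spec_proj N H lam) (mm N Q (spec_proj N H mu)))"

text \<open>D_e, with jump operators S e i (i in the finite index type) and rates h e i.\<close>
definition dissip :: "nat \<Rightarrow> (edge \<Rightarrow> 'i::finite \<Rightarrow> ('g::{finite,ab_group_add}) sop)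
     \<Rightarrow> (edge \<Rightarrow> 'i \<Rightarrow> real \<Rightarrow> real) \<Rightarrow> edge \<Rightarrow> 'g gop \<Rightarrow> 'g gop" where
  "dissip N S h e Q = (\<Sum>i\<in>UNIV. \<Sum>\<omega>\<in>bohr N (Ham N (lattice N) :: 'g gop).
      (let S\<omega> = freq N (Ham N (lattice N)) (at_edge N e (S e i)) \<omega> in
       scal (of_real (h e i \<omega>))
         (mm N (adj S\<omega>) (mm N Q S\<omega>)
          - scal (1/2) (mm N (mm N (adj S\<omega>) S\<omega>) Q + mm N Q (mm N (adj S\<omega>) S\<omega>)))))"

definition davies :: "nat \<Rightarrow> (edge \<Rightarrow> 'i::finite \<Rightarrow> ('g::{finite,ab_group_add}) sop)
     \<Rightarrow> (edge \<Rightarrow> 'i \<Rightarrow> real \<Rightarrow> real) \<Rightarrow> edge set \<Rightarrow> 'g gop \<Rightarrow> 'g gop" where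
  "davies N S h V Q = (\<Sum>e\<in>V. dissip N S h e Q)"

end

theory Submission
  imports Defs "HOL-Computational_Algebra.Fundamental_Theorem_Algebra"
begin

text \<open>
The jump operators of the generator are closed under adjoints and have positive rates. If a Hermitian
Q lies in the kernel, the block weights of the jumps between its eigenspaces are the rates of a
Markov chain on the spectrum of Q with symmetric support, for which the identity function is
harmonic. By the maximum principle no jump connects different eigenvalues, so Q commutes with every
jump operator S(\<omega>).

Commuting with all S(\<omega>) forces Q and its commutator [Q,H] to commute with all operators at every edge of R.
Averaging [Q,H] over the diagonal algebra of an edge e then shows that Q commutes with
A_s + A_s' for the two ends s, s' of e, because the average of a star term over an incident edge is a
constant. Connectivity in both senses supplies another edge of R touching exactly one of s, s', and a second
average separates the two terms. Plaquettes are dual, with averages over the shifts L^g.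

Conversely, the terms of H commute with each other, so the iterated commutators of H with an operator at an
edge of R involve only terms touching R. They commute with Q, and a Vandermonde argument recovers
the components S(\<omega>) from them.
\<close>

section \<open>Matrix algebra\<close>

text \<open>The generator sees the Hamiltonian only as a whole; the difficulty is to reach its
  single terms without knowing its spectrum. Commuting with all S(\<omega>) means commuting with the
  moments sum \<omega>^k S(\<omega>), the iterated commutators of H with S. From k = 0 and k = 1 the
  Jacobi identity gives [[Q,H],S] = [Q,[H,S]] = 0, and the trivial commutant of the jump operators
  extends this to the whole edge algebra. An average over operators that commute with Q and with
  [Q,H] multiplies [Q,H] by a scalar, so Q commutes with the part of H that the average changes. Up
  to normalisation, diagonal averages fix all plaquette terms and shift averages fix all star terms,
  so the two kinds separate. Both connectivities enter because of the torus with N = 2. There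
  distinct edges may share both ends, or border the same two plaquettes, and a region made of such
  edges has no edge touching exactly one of the two cells. But edges sharing both ends never lie on
  a common plaquette, and edges sharing both plaquettes never meet in a vertex.\<close>

lemma finite_lattice: "finite (lattice N)"
proof -
  have "lattice N \<subseteq> {..<N} \<times> {..<N} \<times> UNIV"
    by (auto simp: lattice_def)
  then show ?thesis
    by (rule finite_subset) simp
qed

lemma finite_confs: "finite (confs N :: ('g::{finite,zero}) conf set)"
proof -
  have "confs N = {c :: 'g conf. \<forall>e. (e \<in> lattice N \<longrightarrow> c e \<in> UNIV) \<and> (e \<notin> lattice N \<longrightarrow> c e = 0)}"
    by (auto simp: confs_def)
  then show ?thesis
    using finite_set_of_finite_funs[OF finite_lattice[of N], of "UNIV :: 'g set" 0] by simp
qed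

lemma mm_assoc: "mm N (mm N A B) C = mm N A (mm N B C)"
proof (intro ext)
  fix c c'
  have "mm N (mm N A B) C c c' = (\<Sum>d\<in>confs N. \<Sum>d'\<in>confs N. A c d' * B d' d * C d c')"
    by (simp add: mm_def sum_distrib_right)
  also have "\<dots> = (\<Sum>d'\<in>confs N. \<Sum>d\<in>confs N. A c d' * B d' d * C d c')"
    by (rule sum.swap)
  also have "\<dots> = mm N A (mm N B C) c c'"
    by (simp add: mm_def sum_distrib_left mult.assoc)
  finally show "mm N (mm N A B) C c c' = mm N A (mm N B C) c c'" .
qed

lemma sum_gop_apply: "(\<Sum>i\<in>I. F i) c c' = (\<Sum>i\<in>I. F i c c')" for F :: "_ \<Rightarrow> ('g::zero) gop"
  by (induction I rule: infinite_finite_induct) simp_all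


lemma mm_add_left: "mm N (A + B) C = mm N A C + mm N B C"
  by (simp add: mm_def fun_eq_iff sum.distrib algebra_simps)
lemma mm_add_right: "mm N A (B + C) = mm N A B + mm N A C"
  by (simp add: mm_def fun_eq_iff sum.distrib algebra_simps)
lemma mm_diff_left: "mm N (A - B) C = mm N A C - mm N B C"
  by (simp add: mm_def fun_eq_iff sum_subtractf algebra_simps)
lemma mm_diff_right: "mm N A (B - C) = mm N A B - mm N A C"
  by (simp add: mm_def fun_eq_iff sum_subtractf algebra_simps)
lemma mm_minus_left: "mm N (- A) C = - mm N A C"
  by (simp add: mm_def fun_eq_iff sum_negf)
lemma mm_minus_right: "mm N A (- C) = - mm N A C"
  by (simp add: mm_def fun_eq_iff sum_negf)
lemma mm_zero_left [simp]: "mm N 0 C = 0"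
  by (simp add: mm_def fun_eq_iff)
lemma mm_zero_right [simp]: "mm N A 0 = 0"
  by (simp add: mm_def fun_eq_iff)
lemma mm_scal_left: "mm N (scal k A) B = scal k (mm N A B)"
  by (simp add: mm_def scal_def fun_eq_iff sum_distrib_left mult.assoc)
lemma mm_scal_right: "mm N A (scal k B) = scal k (mm N A B)"
  by (simp add: mm_def scal_def fun_eq_iff sum_distrib_left mult_ac)
lemma mm_sum_left: "mm N (\<Sum>i\<in>I. F i) B = (\<Sum>i\<in>I. mm N (F i) B)"
  unfolding mm_def by (intro ext) (simp add: sum_gop_apply sum_distrib_right, rule sum.swap)
lemma mm_sum_right: "mm N B (\<Sum>i\<in>I. F i) = (\<Sum>i\<in>I. mm N B (F i))"
  unfolding mm_def by (intro ext) (simp add: sum_gop_apply sum_distrib_left, rule sum.swap)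

lemma scal_add: "scal k (A + B) = scal k A + scal k B"
  by (simp add: scal_def fun_eq_iff algebra_simps)
lemma scal_diff: "scal k (A - B) = scal k A - scal k B"
  by (simp add: scal_def fun_eq_iff algebra_simps)
lemma scal_zero [simp]: "scal k 0 = 0" "scal 0 A = 0"
  by (simp_all add: scal_def fun_eq_iff)
lemma scal_one [simp]: "scal 1 A = A"
  by (simp add: scal_def)
lemma scal_scal [simp]: "scal j (scal k A) = scal (j * k) A"
  by (simp add: scal_def mult.assoc)
lemma scal_sum: "scal k (\<Sum>i\<in>I. F i) = (\<Sum>i\<in>I. scal k (F i))"
  by (intro ext) (simp add: scal_def sum_gop_apply sum_distrib_left)

lemma adj_adj [simp]: "adj (adj A) = A"
  by (simp add: adj_def)
lemma adj_mm: "adj (mm N A B) = mm N (adj B) (adj A)"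
  by (simp add: adj_def mm_def fun_eq_iff mult.commute)
lemma adj_add: "adj (A + B) = adj A + adj B"
  by (simp add: adj_def fun_eq_iff)
lemma adj_diff: "adj (A - B) = adj A - adj B"
  by (simp add: adj_def fun_eq_iff)
lemma adj_uminus: "adj (- A) = - adj A"
  by (simp add: adj_def fun_eq_iff)
lemma adj_scal: "adj (scal k A) = scal (cnj k) (adj A)"
  by (simp add: adj_def scal_def fun_eq_iff)
lemma adj_zero [simp]: "adj 0 = 0"
  by (simp add: adj_def fun_eq_iff)
lemma adj_sum: "adj (\<Sum>i\<in>I. F i) = (\<Sum>i\<in>I. adj (F i))"
  by (intro ext) (simp add: adj_def sum_gop_apply)

lemma ops_zero [simp]: "0 \<in> ops N"
  by (simp add: ops_def)
lemma ops_add: "A \<in> ops N \<Longrightarrow> B \<in> ops N \<Longrightarrow> A + B \<in> ops N"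
  by (simp add: ops_def)
lemma ops_diff: "A \<in> ops N \<Longrightarrow> B \<in> ops N \<Longrightarrow> A - B \<in> ops N"
  by (simp add: ops_def)
lemma ops_uminus: "A \<in> ops N \<Longrightarrow> - A \<in> ops N"
  by (simp add: ops_def)
lemma ops_scal: "A \<in> ops N \<Longrightarrow> scal k A \<in> ops N"
  by (simp add: ops_def scal_def)
lemma ops_mm: "A \<in> ops N \<Longrightarrow> B \<in> ops N \<Longrightarrow> mm N A B \<in> ops N"
  by (auto simp: ops_def mm_def intro!: sum.neutral)
lemma ops_adj: "A \<in> ops N \<Longrightarrow> adj A \<in> ops N"
  by (auto simp: ops_def adj_def)
lemma ops_sum: "(\<And>i. i \<in> I \<Longrightarrow> F i \<in> ops N) \<Longrightarrow> (\<Sum>i\<in>I. F i) \<in> ops N"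
  by (induction I rule: infinite_finite_induct) (simp_all add: ops_add)

section \<open>The identity operator and commutation\<close>

definition idop :: "nat \<Rightarrow> ('g::zero) gop" where
  "idop N = (\<lambda>c c'. if c \<in> confs N \<and> c = c' then 1 else 0)"

lemma idop_ops [simp]: "idop N \<in> ops N"
  by (auto simp: ops_def idop_def)

lemma adj_idop [simp]: "adj (idop N) = idop N"
  by (intro ext) (auto simp: adj_def idop_def)

lemma idop_left: "A \<in> ops N \<Longrightarrow> mm N (idop N) A = A" for A :: "('g::{finite,zero}) gop"
proof (intro ext)
  fix c c' assume A: "A \<in> ops N"
  have "mm N (idop N) A c c' = (\<Sum>d\<in>confs N. if c = d then A d c' else 0)"
    unfolding mm_def idop_def by (intro sum.cong) auto
  also have "\<dots> = A c c'"
    using A by (simp add: finite_confs ops_def)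
  finally show "mm N (idop N) A c c' = A c c'" .
qed

lemma idop_right: "A \<in> ops N \<Longrightarrow> mm N A (idop N) = A" for A :: "('g::{finite,zero}) gop"
  using arg_cong[OF idop_left[OF ops_adj], of A N adj] by (simp add: adj_mm)

definition commutes :: "nat \<Rightarrow> ('g::zero) gop \<Rightarrow> 'g gop \<Rightarrow> bool" where
  "commutes N A B \<longleftrightarrow> mm N A B = mm N B A"

lemma commutes_sym: "commutes N A B \<Longrightarrow> commutes N B A"
  by (simp add: commutes_def)
lemma commutes_add: "commutes N A B \<Longrightarrow> commutes N A C \<Longrightarrow> commutes N A (B + C)"
  by (simp add: commutes_def mm_add_left mm_add_right)
lemma commutes_diff: "commutes N A B \<Longrightarrow> commutes N A C \<Longrightarrow> commutes N A (B - C)"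
  by (simp add: commutes_def mm_diff_left mm_diff_right)
lemma commutes_uminus: "commutes N A B \<Longrightarrow> commutes N A (- B)"
  by (simp add: commutes_def mm_minus_left mm_minus_right)
lemma commutes_scal: "commutes N A B \<Longrightarrow> commutes N A (scal k B)"
  by (simp add: commutes_def mm_scal_left mm_scal_right)
lemma commutes_sum: "(\<And>i. i \<in> I \<Longrightarrow> commutes N A (F i)) \<Longrightarrow> commutes N A (\<Sum>i\<in>I. F i)"
  by (simp add: commutes_def mm_sum_left mm_sum_right)
lemma commutes_mm: "commutes N A B \<Longrightarrow> commutes N A C \<Longrightarrow> commutes N A (mm N B C)"
  unfolding commutes_def by (metis mm_assoc)
lemma commutes_idop: "A \<in> ops N \<Longrightarrow> commutes N A (idop N)" for A :: "('g::{finite,zero}) gop"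
  by (simp add: commutes_def idop_left idop_right)

section \<open>The Hilbert-Schmidt norm\<close>

definition tr :: "nat \<Rightarrow> ('g::zero) gop \<Rightarrow> complex" where
  "tr N A = (\<Sum>c\<in>confs N. A c c)"

text \<open>The squared norm; below it serves as the weight of a jump block.\<close>

definition hs :: "nat \<Rightarrow> ('g::zero) gop \<Rightarrow> real" where
  "hs N A = (\<Sum>c\<in>confs N. \<Sum>d\<in>confs N. (cmod (A c d))\<^sup>2)"

lemma tr_diff: "tr N (A - B) = tr N A - tr N B"
  by (simp add: tr_def sum_subtractf)
lemma tr_scal: "tr N (scal k A) = k * tr N A"
  by (simp add: tr_def scal_def sum_distrib_left)
lemma tr_zero [simp]: "tr N 0 = 0"
  by (simp add: tr_def)
lemma tr_sum: "tr N (\<Sum>i\<in>I. F i) = (\<Sum>i\<in>I. tr N (F i))"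
  unfolding tr_def by (simp add: sum_gop_apply, rule sum.swap)

lemma tr_adj_mm: "tr N (mm N (adj A) A) = complex_of_real (hs N A)"
proof -
  have "tr N (mm N (adj A) A) = (\<Sum>c\<in>confs N. \<Sum>d\<in>confs N. complex_of_real ((cmod (A d c))\<^sup>2))"
    unfolding tr_def mm_def adj_def
    by (intro sum.cong refl) (metis complex_norm_square mult.commute of_real_power)
  also have "\<dots> = (\<Sum>d\<in>confs N. \<Sum>c\<in>confs N. complex_of_real ((cmod (A d c))\<^sup>2))"
    by (rule sum.swap)
  finally show ?thesis
    by (simp add: hs_def)
qed

lemma hs_nonneg: "hs N A \<ge> 0"
  by (simp add: hs_def sum_nonneg)

lemma hs_eq_0_iff: "A \<in> ops N \<Longrightarrow> hs N A = 0 \<longleftrightarrow> A = 0" for A :: "('g::{finite,zero}) gop"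
proof
  assume A: "A \<in> ops N" and "hs N A = 0"
  then have "\<forall>c\<in>confs N. \<forall>d\<in>confs N. A c d = 0"
    by (simp add: hs_def sum_nonneg_eq_0_iff finite_confs sum_nonneg)
  with A show "A = 0"
    by (force simp: ops_def fun_eq_iff)
qed (simp add: hs_def)

section \<open>The spectral theorem\<close>

text \<open>Gaussian elimination, one coordinate of \<open>I\<close> per induction step: a vector
  with a nonzero entry there is the pivot and is subtracted from the others. It later supplies an
  annihilating polynomial.\<close>

lemma linear_dependence:
  fixes f :: "'i \<Rightarrow> 'a \<Rightarrow> complex"
  assumes "finite I" "finite J" "card I < card J"
  shows "\<exists>a. (\<exists>i\<in>J. a i \<noteq> 0) \<and> (\<forall>c\<in>I. (\<Sum>i\<in>J. a i * f i c) = 0)"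
  using assms
proof (induction I arbitrary: J f rule: finite_induct)
  case empty
  then have "J \<noteq> {}" by auto
  then show ?case by (intro exI[of _ "\<lambda>_. 1"]) auto
next
  case (insert c I)
  show ?case
  proof (cases "\<forall>i\<in>J. f i c = 0")
    case True
    from insert.IH[of J f] insert.prems insert.hyps
    obtain a where "\<exists>i\<in>J. a i \<noteq> 0" "\<forall>c\<in>I. (\<Sum>i\<in>J. a i * f i c) = 0"
      by auto
    with True show ?thesis by (intro exI[of _ a]) auto
  next
    case False
    then obtain j where j: "j \<in> J" "f j c \<noteq> 0" by auto
    define J' where "J' = J - {j}"
    have J': "finite J'" "card I < card J'" "j \<notin> J'" "J = insert j J'"
      using insert.prems insert.hyps j by (auto simp: J'_def)
    from insert.IH[OF J'(1,2), of "\<lambda>i d. f i d - f i c / f j c * f j d"]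
    obtain a where a: "\<exists>i\<in>J'. a i \<noteq> 0"
      "\<And>d. d \<in> I \<Longrightarrow> (\<Sum>i\<in>J'. a i * (f i d - f i c / f j c * f j d)) = 0"
      by auto
    \<comment> \<open>The coefficient of the pivot collects the multiples of \<open>f j\<close> that
      were subtracted, so a relation among the reduced vectors becomes one among the original
      ones.\<close>
    define b where "b = a(j := - (\<Sum>i\<in>J'. a i * (f i c / f j c)))"
    have b: "(\<Sum>i\<in>J. b i * f i d) = (\<Sum>i\<in>J'. a i * (f i d - f i c / f j c * f j d))" for d
    proof -
      have "(\<Sum>i\<in>J'. b i * f i d) = (\<Sum>i\<in>J'. a i * f i d)"
        using J' by (intro sum.cong) (auto simp: b_def)
      moreover have "(\<Sum>i\<in>J. b i * f i d) = b j * f j d + (\<Sum>i\<in>J'. b i * f i d)"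
        using J' by simp
      ultimately show ?thesis
        by (simp add: b_def algebra_simps sum_subtractf sum_distrib_left sum_distrib_right)
    qed
    have "(\<Sum>i\<in>J. b i * f i d) = 0" if "d \<in> insert c I" for d
      using that a(2) j(2) by (auto simp: b)
    moreover have "\<exists>i\<in>J. b i \<noteq> 0"
      using a(1) J' by (auto simp: b_def)
    ultimately show ?thesis by blast
  qed
qed

section \<open>Action on vectors and Krylov vectors\<close>

definition supp_on :: "nat \<Rightarrow> (('g::zero) conf \<Rightarrow> complex) \<Rightarrow> bool" where
  "supp_on N v \<longleftrightarrow> (\<forall>c. c \<notin> confs N \<longrightarrow> v c = 0)"

lemma mv_mv: "mv N A (mv N B v) = mv N (mm N A B) v"
proof
  fix c
  have "mv N A (mv N B v) c = (\<Sum>d\<in>confs N. \<Sum>d'\<in>confs N. A c d * B d d' * v d')"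
    by (simp add: mv_def sum_distrib_left mult.assoc)
  also have "\<dots> = (\<Sum>d'\<in>confs N. \<Sum>d\<in>confs N. A c d * B d d' * v d')"
    by (rule sum.swap)
  finally show "mv N A (mv N B v) c = mv N (mm N A B) v c"
    by (simp add: mv_def mm_def sum_distrib_right)
qed

lemma mv_lin: "mv N A (\<lambda>c. k * v c + w c) = (\<lambda>c. k * mv N A v c + mv N A w c)"
  by (simp add: mv_def fun_eq_iff sum.distrib sum_distrib_left algebra_simps)
lemma mv_scaled: "mv N A (\<lambda>c. k * v c) = (\<lambda>c. k * mv N A v c)"
  by (simp add: mv_def fun_eq_iff sum_distrib_left algebra_simps)
lemma mv_zero: "mv N A (\<lambda>c. 0) = (\<lambda>c. 0)"
  by (simp add: mv_def)
lemma mv_op_scal: "mv N (scal k A) v = (\<lambda>c. k * mv N A v c)"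
  by (simp add: mv_def scal_def sum_distrib_left mult.assoc)
lemma mv_op_sum: "mv N (\<Sum>i\<in>I. F i) v = (\<lambda>c. \<Sum>i\<in>I. mv N (F i) v c)"
  unfolding mv_def
  by (rule ext, subst sum.swap) (simp add: sum_gop_apply sum_distrib_right)
lemma mv_idop: "supp_on N v \<Longrightarrow> mv N (idop N) v = v" for v :: "('g::{finite,zero}) conf \<Rightarrow> complex"
proof
  fix c assume v: "supp_on N v"
  have "mv N (idop N) v c = (\<Sum>d\<in>confs N. if c = d then v d else 0)"
    unfolding mv_def idop_def by (intro sum.cong) auto
  also have "\<dots> = v c"
    using v by (simp add: finite_confs supp_on_def)
  finally show "mv N (idop N) v c = v c" .
qed
lemma supp_on_mv: "A \<in> ops N \<Longrightarrow> supp_on N (mv N A v)"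
  by (auto simp: supp_on_def mv_def ops_def intro!: sum.neutral)

lemma mv_column: "mv N A (\<lambda>c. B c d) = (\<lambda>c. mm N A B c d)"
  by (simp add: mv_def mm_def)
lemma supp_on_column: "A \<in> ops N \<Longrightarrow> supp_on N (\<lambda>c. A c d)"
  by (auto simp: supp_on_def ops_def)

text \<open>This is the vector p(A) v, evaluated by Horner's scheme; folding over the coefficients
  avoids powers of \<open>A\<close>.\<close>

definition krylov :: "nat \<Rightarrow> ('g::zero) gop \<Rightarrow> ('g conf \<Rightarrow> complex) \<Rightarrow> complex poly \<Rightarrow> 'g conf \<Rightarrow> complex"
  where "krylov N A v p = fold_coeffs (\<lambda>a w c. a * v c + mv N A w c) p (\<lambda>_. 0)"

lemma krylov_0 [simp]: "krylov N A v 0 = (\<lambda>_. 0)"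
  by (simp add: krylov_def)

lemma krylov_pCons: "krylov N A v (pCons a p) = (\<lambda>c. a * v c + mv N A (krylov N A v p) c)"
  by (cases "p = 0 \<and> a = 0") (auto simp: krylov_def mv_zero)

lemma krylov_add: "krylov N A v (p + q) c = krylov N A v p c + krylov N A v q c"
proof (induction p q arbitrary: c rule: poly_induct2)
  case (pCons a p b q)
  have "mv N A (krylov N A v (p + q)) = (\<lambda>c. mv N A (krylov N A v p) c + mv N A (krylov N A v q) c)"
    using mv_lin[of N A 1 "krylov N A v p" "krylov N A v q"] ext[of "krylov N A v (p + q)", OF pCons]
    by simp
  then show ?case by (simp add: krylov_pCons algebra_simps)
qed auto

lemma krylov_smult: "krylov N A v (smult k p) = (\<lambda>c. k * krylov N A v p c)"
  by (induction p) (auto simp: krylov_pCons mv_scaled algebra_simps)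

lemma krylov_linear_factor:
  "krylov N A v ([:- r, 1:] * q) = (\<lambda>c. mv N A (krylov N A v q) c - r * krylov N A v q c)"
proof -
  have *: "[:- r, 1:] * q = smult (- r) q + pCons 0 q" by simp
  show ?thesis
    unfolding * by (rule ext) (simp only: krylov_add krylov_smult krylov_pCons, simp)
qed

lemma krylov_sum_monom:
  "krylov N A v (\<Sum>i\<in>I. monom (a i) i) c = (\<Sum>i\<in>I. a i * krylov N A v (monom 1 i) c)"
proof (induction I rule: infinite_finite_induct)
  case (insert i I)
  have "monom (a i) i = smult (a i) (monom 1 i)" by (simp add: smult_monom)
  then show ?case using insert by (simp add: krylov_add krylov_smult)
qed auto

text \<open>The Krylov vectors of a nonzero column of \<open>P\<close> stay in the range of
  \<open>P\<close>, because \<open>P\<close> commutes with \<open>H\<close>. They satisfy a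
  polynomial relation; a complex root of one of least degree is an eigenvalue, and the cofactor
  yields an eigenvector. The projection \<open>P\<close> is carried along so that eigenvectors can
  be split off successively.\<close>

lemma eigenvector_in_range:
  fixes H P :: "('g::{finite,zero}) gop"
  assumes H: "H \<in> ops N" and P: "P \<in> ops N" "mm N P P = P" "commutes N P H" "P \<noteq> 0"
  obtains v r where "supp_on N v" "v \<noteq> (\<lambda>_. 0)" "mv N P v = v" "mv N H v = (\<lambda>c. r * v c)"
proof -
  from P(4) obtain d where d: "(\<lambda>c. P c d) \<noteq> (\<lambda>_. 0)"
    by (metis zero_fun_apply ext)
  define v0 where "v0 = (\<lambda>c. P c d)"
  have v0: "v0 \<noteq> (\<lambda>_. 0)" "supp_on N v0" "mv N P v0 = v0"
    using d P by (auto simp: v0_def supp_on_column mv_column)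
  have kP: "mv N P (krylov N H v0 p) = krylov N H v0 p" for p
  proof (induction p)
    case (pCons a p)
    have "mv N P (mv N H (krylov N H v0 p)) = mv N H (krylov N H v0 p)"
      using P(3) pCons unfolding commutes_def by (metis mv_mv)
    then show ?case by (simp add: krylov_pCons mv_lin v0)
  qed (simp add: mv_zero)
  have ks: "supp_on N (krylov N H v0 p)" for p
    by (metis P(1) kP supp_on_mv)
  \<comment> \<open>There are n + 1 vectors H^i v0 with i \<le> n, but only n coordinates.\<close>
  define n where "n = card (confs N :: 'g conf set)"
  obtain a where a: "\<exists>i\<in>{..n}. a i \<noteq> 0"
    "\<forall>c\<in>confs N. (\<Sum>i\<in>{..n}. a i * krylov N H v0 (monom 1 i) c) = 0"
    using linear_dependence[OF finite_confs[of N], of "{..n}" "\<lambda>i. krylov N H v0 (monom 1 i)"]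
    by (auto simp: n_def)
  define p0 where "p0 = (\<Sum>i\<in>{..n}. monom (a i) i)"
  have "krylov N H v0 p0 c = 0" for c
    using a(2) ks[of p0] by (cases "c \<in> confs N") (auto simp: p0_def krylov_sum_monom supp_on_def)
  moreover have "p0 \<noteq> 0"
  proof -
    from a(1) obtain i where i: "i \<le> n" "a i \<noteq> 0" by auto
    then have "coeff p0 i = a i" by (simp add: p0_def coeff_sum)
    with i show ?thesis by auto
  qed
  ultimately have ex: "\<exists>p. p \<noteq> 0 \<and> krylov N H v0 p = (\<lambda>_. 0)"
    by auto
  define p where "p = arg_min degree (\<lambda>p. p \<noteq> 0 \<and> krylov N H v0 p = (\<lambda>_. 0))"
  have p: "p \<noteq> 0" "krylov N H v0 p = (\<lambda>_. 0)"
    using arg_min_natI[of "\<lambda>p. p \<noteq> 0 \<and> krylov N H v0 p = (\<lambda>_. 0)" _ degree] ex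
    unfolding p_def by blast+
  have pmin: "degree p \<le> degree q" if "q \<noteq> 0" "krylov N H v0 q = (\<lambda>_. 0)" for q
    using arg_min_nat_le[of "\<lambda>p. p \<noteq> 0 \<and> krylov N H v0 p = (\<lambda>_. 0)" q degree] that
    unfolding p_def by blast
  have "degree p \<noteq> 0"
  proof
    assume "degree p = 0"
    then obtain k where k: "p = [:k:]" by (rule degree_eq_zeroE)
    with p have "k \<noteq> 0" "(\<lambda>c. k * v0 c) = (\<lambda>_. 0)"
      by (auto simp: krylov_pCons mv_zero)
    with v0(1) show False by (auto simp: fun_eq_iff)
  qed
  then have "\<not> constant (poly p)" by (simp add: constant_degree)
  then obtain r where "poly p r = 0"
    using fundamental_theorem_of_algebra by blast
  then obtain q where q: "p = [:- r, 1:] * q"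
    by (metis dvdE poly_eq_0_iff_dvd)
  have q0: "q \<noteq> 0" using q p(1) by auto
  \<comment> \<open>By minimality the cofactor \<open>q\<close>, having smaller degree, does not
    annihilate \<open>v0\<close>, while (H - r) q(H) v0 = 0.\<close>
  have "degree p = Suc (degree q)"
    unfolding q using q0 by (subst degree_mult_eq) auto
  then have "krylov N H v0 q \<noteq> (\<lambda>_. 0)" using pmin[OF q0] by auto
  moreover have "mv N H (krylov N H v0 q) = (\<lambda>c. r * krylov N H v0 q c)"
    using p(2) unfolding q krylov_linear_factor by (simp add: fun_eq_iff)
  ultimately show ?thesis
    using that[of "krylov N H v0 q" r] ks kP by blast
qed

definition rank_one :: "('a \<Rightarrow> complex) \<Rightarrow> 'a \<Rightarrow> 'a \<Rightarrow> complex" where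
  "rank_one v = (\<lambda>c c'. v c * cnj (v c'))"

text \<open>The projection is |v><v| divided by the squared norm of an eigenvector v in the range of
  \<open>P\<close>.\<close>

lemma eigenprojection_below:
  fixes H P :: "('g::{finite,zero}) gop"
  assumes H: "H \<in> ops N" "adj H = H"
    and P: "P \<in> ops N" "mm N P P = P" "commutes N P H" "P \<noteq> 0"
  obtains p r where "p \<in> ops N" "adj p = p" "mm N p p = p" "tr N p = 1" "mm N P p = p"
    "mm N H p = scal (complex_of_real r) p"
proof -
  obtain v r where v: "supp_on N v" "v \<noteq> (\<lambda>_. 0)" "mv N P v = v" "mv N H v = (\<lambda>c. r * v c)"
    by (rule eigenvector_in_range[OF H(1) P])
  define m where "m = (\<Sum>c\<in>confs N. (cmod (v c))\<^sup>2)"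
  obtain c where "v c \<noteq> 0" using v(2) by auto
  with v(1) have "c \<in> confs N" "0 < (cmod (v c))\<^sup>2" by (auto simp: supp_on_def)
  then have m: "m > 0"
    unfolding m_def by (intro sum_pos2[OF finite_confs]) auto
  have vv: "(\<Sum>c\<in>confs N. cnj (v c) * v c) = of_real m"
    unfolding m_def of_real_sum
    by (intro sum.cong refl) (metis complex_norm_square mult.commute of_real_power)
  define p where "p = scal (1 / of_real m) (rank_one v)"
  have p_ops: "p \<in> ops N"
    using v(1) by (auto simp: p_def rank_one_def ops_def scal_def supp_on_def)
  have p_adj: "adj p = p"
    by (auto simp: p_def rank_one_def adj_def scal_def fun_eq_iff)
  have pp: "mm N p p = p"
  proof (intro ext)
    fix c c'
    have "mm N p p c c' = v c * cnj (v c') / (of_real m)\<^sup>2 * (\<Sum>d\<in>confs N. cnj (v d) * v d)"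
      by (simp add: mm_def p_def scal_def rank_one_def sum_distrib_left sum_divide_distrib power2_eq_square mult_ac)
    also have "\<dots> = p c c'"
      using m by (simp add: vv p_def scal_def rank_one_def power2_eq_square)
    finally show "mm N p p c c' = p c c'" .
  qed
  have tp: "tr N p = 1"
  proof -
    have "tr N p = (\<Sum>d\<in>confs N. cnj (v d) * v d) / of_real m"
      by (simp add: tr_def p_def scal_def rank_one_def sum_divide_distrib mult.commute)
    then show ?thesis using m by (simp add: vv)
  qed
  have mvp: "mm N A p = (\<lambda>c c'. 1 / of_real m * (mv N A v c * cnj (v c')))" for A
    by (simp add: mm_def mv_def p_def scal_def rank_one_def fun_eq_iff sum_distrib_left sum_distrib_right mult_ac)
  have Pp: "mm N P p = p"
    by (simp add: mvp v) (simp add: p_def scal_def rank_one_def)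
  have Hp: "mm N H p = scal r p"
    by (simp add: mvp v) (simp add: p_def scal_def rank_one_def mult_ac)
  \<comment> \<open>Evaluating p H p from the right and from the left gives r p and its conjugate
    multiple; as p has trace 1, the eigenvalue is real.\<close>
  have "scal r p = mm N p (mm N H p)" by (simp add: Hp mm_scal_right pp)
  moreover have "mm N p H = scal (cnj r) p"
    using arg_cong[OF Hp, of adj] by (simp add: adj_mm adj_scal H p_adj)
  ultimately have "scal r p = scal (cnj r) p"
    by (metis mm_assoc mm_scal_left pp)
  then have "tr N (scal r p) = tr N (scal (cnj r) p)" by simp
  then have "r = cnj r" by (simp add: tr_scal tp)
  then have "r = of_real (Re r)" by (simp add: complex_eq_iff)
  then show ?thesis
    using that[OF p_ops p_adj pp tp Pp] Hp by metis
qed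

text \<open>The eigenvalues \<open>r k\<close> may repeat; projections to equal eigenvalues are
  merged later into the spectral projections.\<close>

definition resolved :: "nat \<Rightarrow> ('g::zero) gop \<Rightarrow> nat \<Rightarrow> 'g gop \<Rightarrow> (nat \<Rightarrow> 'g gop) \<Rightarrow> (nat \<Rightarrow> real) \<Rightarrow> bool" where
  "resolved N H n P p r \<longleftrightarrow>
     (\<forall>k<n. p k \<in> ops N \<and> adj (p k) = p k \<and> mm N H (p k) = scal (complex_of_real (r k)) (p k)) \<and>
     (\<forall>k<n. \<forall>l<n. mm N (p k) (p l) = (if k = l then p k else 0)) \<and> (\<Sum>k<n. p k) = P"

text \<open>Induction on the trace, which for an orthogonal projection is its rank: each p0 split
  off has trace 1 and leaves the projection P - p0. Trace 0 forces P = 0, because the trace of an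
  orthogonal projection is its squared Hilbert-Schmidt norm.\<close>

lemma eigenprojections:
  fixes H P :: "('g::{finite,zero}) gop"
  assumes H: "H \<in> ops N" "adj H = H"
    and "P \<in> ops N" "adj P = P" "mm N P P = P" "commutes N P H" "tr N P = of_nat n"
  shows "\<exists>p r. resolved N H n P p r"
  using assms(3-7)
proof (induction n arbitrary: P)
  case 0
  then have "complex_of_real (hs N P) = 0"
    using tr_adj_mm[of N P] by simp
  with 0 have "P = 0" by (simp add: hs_eq_0_iff)
  then show ?case by (simp add: resolved_def func_zero)
next
  case (Suc n)
  have "tr N P \<noteq> 0" using Suc.prems(5) by (simp del: of_nat_Suc)
  then have "P \<noteq> 0" by (metis tr_zero)
  with Suc.prems obtain p0 r0 where p0: "p0 \<in> ops N" "adj p0 = p0" "mm N p0 p0 = p0" "tr N p0 = 1"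
    "mm N P p0 = p0" "mm N H p0 = scal (complex_of_real r0) p0"
    using eigenprojection_below[OF H] by metis
  have p0P: "mm N p0 P = p0"
    using arg_cong[OF p0(5), of adj] unfolding adj_mm p0(2) Suc.prems(2) .
  have p0H: "mm N p0 H = scal (complex_of_real r0) p0"
    using arg_cong[OF p0(6), of adj] unfolding adj_mm adj_scal p0(2) H(2) by simp
  define P' where "P' = P - p0"
  have P': "P' \<in> ops N" "adj P' = P'" "mm N P' P' = P'" "commutes N P' H" "tr N P' = of_nat n"
    using Suc.prems p0 p0P p0H
    by (simp_all add: P'_def ops_diff adj_diff mm_diff_left mm_diff_right tr_diff commutes_def)
  from Suc.IH[OF P'] obtain p r where
    p: "\<And>k. k < n \<Longrightarrow> p k \<in> ops N \<and> adj (p k) = p k \<and> mm N H (p k) = scal (complex_of_real (r k)) (p k)"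
    and orth: "\<And>k l. k < n \<Longrightarrow> l < n \<Longrightarrow> mm N (p k) (p l) = (if k = l then p k else 0)"
    and sum: "(\<Sum>k<n. p k) = P'"
    unfolding resolved_def by blast
  have 1: "mm N (p k) p0 = 0" if "k < n" for k
  proof -
    have "mm N (p k) P' = p k"
      unfolding sum[symmetric] mm_sum_right using that by (simp add: orth)
    then have "mm N (p k) p0 = mm N (p k) (mm N P' p0)"
      by (metis mm_assoc)
    moreover have "mm N P' p0 = 0" by (simp add: P'_def mm_diff_left p0)
    ultimately show ?thesis by simp
  qed
  have 2: "mm N p0 (p k) = 0" if "k < n" for k
    using arg_cong[OF 1[OF that], of adj] p[OF that] p0 by (simp add: adj_mm)
  define p' r' where "p' = p(n := p0)" and "r' = r(n := r0)"
  have "(\<Sum>k<n. p' k) = (\<Sum>k<n. p k)" by (intro sum.cong) (auto simp: p'_def)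
  then have "(\<Sum>k<Suc n. p' k) = P" using sum by (simp add: p'_def P'_def)
  moreover have "\<forall>k<Suc n. p' k \<in> ops N \<and> adj (p' k) = p' k \<and> mm N H (p' k) = scal (complex_of_real (r' k)) (p' k)"
    using p p0 by (auto simp: p'_def r'_def less_Suc_eq)
  moreover have "\<forall>k<Suc n. \<forall>l<Suc n. mm N (p' k) (p' l) = (if k = l then p' k else 0)"
    using orth 1 2 p0 by (auto simp: p'_def less_Suc_eq)
  ultimately have "resolved N H (Suc n) P p' r'"
    unfolding resolved_def by blast
  then show ?case by blast
qed

text \<open>\<open>spec_proj\<close> is a definite description, so existence and uniqueness come
  first. Projections with equal eigenvalue are merged to E x, which is shown to be the described
  operator, and the remaining facts are read off from E. They hold for every real x: off the
  spectrum E x is 0.\<close>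

lemma spec_proj_properties:
  fixes H :: "('g::{finite,zero}) gop"
  assumes H: "H \<in> ops N" "adj H = H"
  shows finite_eigvals: "finite (eigvals N H)"
    and spec_proj_ops: "spec_proj N H x \<in> ops N"
    and adj_spec_proj: "adj (spec_proj N H x) = spec_proj N H x"
    and spec_proj_mm: "mm N (spec_proj N H x) (spec_proj N H y) = (if x = y then spec_proj N H x else 0)"
    and H_spec_proj: "mm N H (spec_proj N H x) = scal (of_real x) (spec_proj N H x)"
    and spec_proj_H: "mm N (spec_proj N H x) H = scal (of_real x) (spec_proj N H x)"
    and sum_spec_proj: "(\<Sum>x\<in>eigvals N H. spec_proj N H x) = idop N"
proof -
  define n where "n = card (confs N :: 'g conf set)"
  have "tr N (idop N :: 'g gop) = of_nat n"
    by (simp add: tr_def idop_def n_def)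
  then have "\<exists>p r. resolved N H n (idop N) p r"
    by (intro eigenprojections[OF H]) (simp_all add: idop_left commutes_sym commutes_idop H)
  then obtain p r where
    p: "\<And>k. k < n \<Longrightarrow> p k \<in> ops N \<and> adj (p k) = p k \<and> mm N H (p k) = scal (complex_of_real (r k)) (p k)"
    and orth: "\<And>k l. k < n \<Longrightarrow> l < n \<Longrightarrow> mm N (p k) (p l) = (if k = l then p k else 0)"
    and sum: "(\<Sum>k<n. p k) = idop N"
    unfolding resolved_def by blast
  have pH: "mm N (p k) H = scal (of_real (r k)) (p k)" if "k < n" for k
  proof -
    have "mm N (p k) H = adj (mm N H (p k))"
      unfolding adj_mm using p[OF that] H by simp
    also have "\<dots> = scal (of_real (r k)) (p k)"
      using p[OF that] by (simp add: adj_scal)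
    finally show ?thesis .
  qed
  define E where "E x = (\<Sum>k\<in>{k. k < n \<and> r k = x}. p k)" for x
  have E_ops: "E x \<in> ops N" for x using p by (auto simp: E_def intro: ops_sum)
  have E_adj: "adj (E x) = E x" for x using p by (auto simp: E_def adj_sum intro!: sum.cong)
  have E_mm: "mm N (E x) (E y) = (if x = y then E x else 0)" for x y
  proof -
    have "mm N (E x) (E y) = (\<Sum>k\<in>{k. k < n \<and> r k = x}. \<Sum>l\<in>{l. l < n \<and> r l = y}. if k = l then p k else 0)"
      unfolding E_def mm_sum_left unfolding mm_sum_right by (intro sum.cong refl) (auto simp: orth)
    also have "\<dots> = (\<Sum>k\<in>{k. k < n \<and> r k = x}. if r k = y then p k else 0)"
      by (rule sum.cong[OF refl]) simp
    also have "\<dots> = (if x = y then E x else 0)"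
      by (cases "x = y") (auto simp: E_def intro!: sum.neutral sum.cong)
    finally show ?thesis .
  qed
  have HE: "mm N H (E x) = scal (of_real x) (E x)" for x
    unfolding E_def mm_sum_right scal_sum using p by (intro sum.cong) auto
  have EH: "mm N (E x) H = scal (of_real x) (E x)" for x
    unfolding E_def mm_sum_left scal_sum using pH by (intro sum.cong) auto
  have fixE: "mv N (E x) v = v \<longleftrightarrow> mv N H v = (\<lambda>c. of_real x * v c)" if v: "supp_on N v" for x v
  proof
    assume "mv N (E x) v = v"
    then show "mv N H v = (\<lambda>c. of_real x * v c)"
      using mv_mv[of N H "E x" v] by (simp add: HE mv_op_scal)
  next
    assume Hv: "mv N H v = (\<lambda>c. of_real x * v c)"
    \<comment> \<open>Projections to other eigenvalues annihilate v, so expanding v by the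
      resolution of the identity leaves E x v.\<close>
    have z: "mv N (p k) v = (\<lambda>_. 0)" if "k < n" "r k \<noteq> x" for k
    proof -
      have "mv N (p k) (mv N H v) = (\<lambda>c. of_real (r k) * mv N (p k) v c)"
        unfolding mv_mv pH[OF that(1)] mv_op_scal ..
      then have "of_real (r k) * mv N (p k) v c = of_real x * mv N (p k) v c" for c
        unfolding Hv mv_scaled by (metis (no_types))
      with that(2) show ?thesis by auto
    qed
    have "v = mv N (\<Sum>k<n. p k) v" using v by (simp add: sum mv_idop)
    also have "\<dots> = (\<lambda>c. \<Sum>k<n. mv N (p k) v c)" by (rule mv_op_sum)
    also have "\<dots> = (\<lambda>c. \<Sum>k\<in>{k. k < n \<and> r k = x}. mv N (p k) v c)"
      by (rule ext, rule sum.mono_neutral_right) (auto simp: z)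
    also have "\<dots> = mv N (E x) v" by (simp add: E_def mv_op_sum)
    finally show "mv N (E x) v = v" by simp
  qed
  have E_spec: "spec_proj N H x = E x" for x
    unfolding spec_proj_def
  proof (rule the_equality)
    show "E x \<in> ops N \<and> adj (E x) = E x \<and> mm N (E x) (E x) = E x \<and>
      (\<forall>v. (\<forall>c. c \<notin> confs N \<longrightarrow> v c = 0) \<longrightarrow>
          (mv N (E x) v = v \<longleftrightarrow> mv N H v = (\<lambda>c. of_real x * v c)))"
      using E_ops E_adj E_mm fixE by (simp add: supp_on_def)
  next
    fix P assume P: "P \<in> ops N \<and> adj P = P \<and> mm N P P = P \<and>
      (\<forall>v. (\<forall>c. c \<notin> confs N \<longrightarrow> v c = 0) \<longrightarrow>
          (mv N P v = v \<longleftrightarrow> mv N H v = (\<lambda>c. of_real x * v c)))"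
    then have fixP: "mv N P v = v \<longleftrightarrow> mv N (E x) v = v" if "supp_on N v" for v
      using that fixE[OF that] by (simp add: supp_on_def)
    \<comment> \<open>P and E x have the same fixed vectors, so each fixes the columns of the other;
      taking the adjoint of P (E x) = E x then identifies the two.\<close>
    have "mm N P (E x) c d = E x c d" for c d
      using fixP[OF supp_on_column[OF E_ops], of x d] by (simp add: mv_column E_mm fun_eq_iff)
    moreover have "mm N (E x) P c d = P c d" for c d
      using fixP[of "\<lambda>c. P c d"] P by (simp add: mv_column supp_on_column fun_eq_iff)
    ultimately have "mm N P (E x) = E x" "mm N (E x) P = P" by (auto intro!: ext)
    then have "adj (mm N P (E x)) = adj (E x)" by simp
    then have "mm N (E x) P = E x" unfolding adj_mm using P E_adj by simp
    with \<open>mm N (E x) P = P\<close> show "P = E x" by simp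
  qed
  have ev: "x \<in> eigvals N H \<longleftrightarrow> E x \<noteq> 0" for x
  proof
    assume "x \<in> eigvals N H"
    then obtain v where v: "supp_on N v" "v \<noteq> (\<lambda>_. 0)" "mv N H v = (\<lambda>c. of_real x * v c)"
      by (auto simp: eigvals_def supp_on_def)
    then have "mv N (E x) v = v" using fixE by blast
    with v(2) show "E x \<noteq> 0" by (auto simp: mv_def)
  next
    assume "E x \<noteq> 0"
    then obtain d where "(\<lambda>c. E x c d) \<noteq> (\<lambda>_. 0)" by (metis zero_fun_apply ext)
    moreover have "mv N H (\<lambda>c. E x c d) = (\<lambda>c. of_real x * E x c d)"
      by (simp add: mv_column HE scal_def)
    ultimately show "x \<in> eigvals N H"
      using supp_on_column[OF E_ops, of x d] by (auto simp: eigvals_def supp_on_def intro!: exI[of _ "\<lambda>c. E x c d"])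
  qed
  have sub: "eigvals N H \<subseteq> r ` {..<n}"
  proof
    fix x assume "x \<in> eigvals N H"
    then have "{k. k < n \<and> r k = x} \<noteq> {}" by (auto simp: ev E_def simp del: Collect_empty_eq)
    then show "x \<in> r ` {..<n}" by auto
  qed
  show "finite (eigvals N H)" using sub by (rule finite_subset) simp
  have "(\<Sum>x\<in>eigvals N H. E x) = (\<Sum>x\<in>r ` {..<n}. E x)"
    by (rule sum.mono_neutral_left) (use sub ev in auto)
  also have "\<dots> = (\<Sum>x\<in>r ` {..<n}. \<Sum>k\<in>{k \<in> {..<n}. r k = x}. p k)"
    by (simp add: E_def)
  also have "\<dots> = (\<Sum>k<n. p k)"
    by (rule sum.group) auto
  finally show "(\<Sum>x\<in>eigvals N H. spec_proj N H x) = idop N"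
    by (simp add: E_spec sum)
  show "spec_proj N H x \<in> ops N" "adj (spec_proj N H x) = spec_proj N H x"
    "mm N (spec_proj N H x) (spec_proj N H y) = (if x = y then spec_proj N H x else 0)"
    "mm N H (spec_proj N H x) = scal (of_real x) (spec_proj N H x)"
    "mm N (spec_proj N H x) H = scal (of_real x) (spec_proj N H x)"
    by (simp_all only: E_spec E_ops E_adj E_mm HE EH)
qed

section \<open>Frequency components\<close>

lemma bohr_image: "bohr N H = (\<lambda>(x, y). x - y) ` (eigvals N H \<times> eigvals N H)"
  by (auto simp: bohr_def)

lemma finite_bohr:
  fixes H :: "('g::{finite,zero}) gop"
  assumes "H \<in> ops N" "adj H = H"
  shows "finite (bohr N H)"
  unfolding bohr_image using finite_eigvals[OF assms] by blast

lemma uminus_bohr: "\<omega> \<in> bohr N H \<Longrightarrow> - \<omega> \<in> bohr N H"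
  by (force simp: bohr_def)

lemma freq_ops:
  fixes H :: "('g::{finite,zero}) gop"
  assumes "H \<in> ops N" "adj H = H" "Q \<in> ops N"
  shows "freq N H Q \<omega> \<in> ops N"
  unfolding freq_def using assms
  by (intro ops_sum) (auto intro!: ops_mm spec_proj_ops)

text \<open>The adjoint exchanges the two spectral projections of a block and so reverses the energy
  difference.\<close>

lemma adj_freq:
  fixes H :: "('g::{finite,zero}) gop"
  assumes H: "H \<in> ops N" "adj H = H"
  shows "adj (freq N H Q \<omega>) = freq N H (adj Q) (- \<omega>)"
  unfolding freq_def adj_sum
  by (rule sum.reindex_bij_witness[of _ prod.swap prod.swap])
     (auto simp: adj_mm adj_spec_proj[OF H] mm_assoc)

lemma sum_freq:
  fixes H :: "('g::{finite,zero}) gop"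
  assumes H: "H \<in> ops N" "adj H = H" and Q: "Q \<in> ops N"
  shows "(\<Sum>\<omega>\<in>bohr N H. freq N H Q \<omega>) = Q"
proof -
  let ?E = "eigvals N H" and ?P = "spec_proj N H"
  let ?F = "\<lambda>(x, y). mm N (?P x) (mm N Q (?P y))"
  have "freq N H Q \<omega> = (\<Sum>z\<in>{z \<in> ?E \<times> ?E. (\<lambda>(x, y). x - y) z = \<omega>}. ?F z)" for \<omega>
    unfolding freq_def by (rule sum.cong) auto
  then have "(\<Sum>\<omega>\<in>bohr N H. freq N H Q \<omega>) =
      (\<Sum>\<omega>\<in>bohr N H. \<Sum>z\<in>{z \<in> ?E \<times> ?E. (\<lambda>(x, y). x - y) z = \<omega>}. ?F z)"
    by simp
  also have "\<dots> = sum ?F (?E \<times> ?E)"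
    using finite_eigvals[OF H] finite_bohr[OF H]
    by (intro sum.group) (auto simp: bohr_image)
  also have "\<dots> = (\<Sum>x\<in>?E. \<Sum>y\<in>?E. mm N (?P x) (mm N Q (?P y)))"
    by (rule sum.cartesian_product[symmetric])
  also have "\<dots> = mm N (\<Sum>x\<in>?E. ?P x) (mm N Q (\<Sum>y\<in>?E. ?P y))"
    by (simp only: mm_sum_left) (simp only: mm_sum_right)
  also have "\<dots> = Q"
    using Q by (simp add: sum_spec_proj[OF H] idop_left idop_right)
  finally show ?thesis .
qed

text \<open>Each block P_x Q P_y is an eigenvector, for x - y, of the commutator with H. This turns
  iterated commutators into moments of the frequency components.\<close>

lemma commutator_freq:
  fixes H :: "('g::{finite,zero}) gop"
  assumes H: "H \<in> ops N" "adj H = H"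
  shows "mm N H (freq N H Q \<omega>) - mm N (freq N H Q \<omega>) H = scal (of_real \<omega>) (freq N H Q \<omega>)"
  unfolding freq_def mm_sum_left mm_sum_right scal_sum sum_subtractf[symmetric]
proof (rule sum.cong[OF refl])
  fix z assume "z \<in> {(x, y) \<in> eigvals N H \<times> eigvals N H. x - y = \<omega>}"
  then obtain x y where z: "z = (x, y)" "\<omega> = x - y" by auto
  let ?T = "mm N (spec_proj N H x) (mm N Q (spec_proj N H y))"
  have "mm N H ?T = scal (of_real x) ?T"
    by (simp add: mm_assoc[symmetric] H_spec_proj[OF H] mm_scal_left)
  moreover have "mm N ?T H = scal (of_real y) ?T"
    by (simp add: mm_assoc spec_proj_H[OF H] mm_scal_right)
  moreover have "scal (of_real x) ?T - scal (of_real y) ?T = scal (of_real \<omega>) ?T"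
    by (simp add: scal_def fun_eq_iff z algebra_simps)
  ultimately show "mm N H (case z of (x, y) \<Rightarrow> mm N (spec_proj N H x) (mm N Q (spec_proj N H y))) -
         mm N (case z of (x, y) \<Rightarrow> mm N (spec_proj N H x) (mm N Q (spec_proj N H y))) H =
         scal (of_real \<omega>) (case z of (x, y) \<Rightarrow> mm N (spec_proj N H x) (mm N Q (spec_proj N H y)))"
    by (simp add: z)
qed

section \<open>The kernel of a generator whose jump operators are closed under adjoints\<close>

text \<open>One summand of \<open>dissip\<close>, isolated so that the generator becomes a single
  sum over jumps.\<close>

definition lindblad :: "nat \<Rightarrow> real \<Rightarrow> ('g::zero) gop \<Rightarrow> 'g gop \<Rightarrow> 'g gop" where
  "lindblad N w S Q = scal (of_real w) (mm N (adj S) (mm N Q S)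
     - scal (1/2) (mm N (mm N (adj S) S) Q + mm N Q (mm N (adj S) S)))"

lemma lindblad_commuting:
  assumes "commutes N Q S" "commutes N Q (adj S)"
  shows "lindblad N w S Q = 0"
proof -
  have "mm N (adj S) (mm N Q S) = mm N (mm N (adj S) S) Q"
    using assms(1) by (simp add: commutes_def mm_assoc)
  moreover have "mm N Q (mm N (adj S) S) = mm N (mm N (adj S) S) Q"
    using commutes_mm[OF assms(2,1)] by (simp add: commutes_def)
  ultimately show ?thesis
    by (simp add: lindblad_def scal_def fun_eq_iff)
qed

lemma lindblad_add: "lindblad N w S (Q + Q') = lindblad N w S Q + lindblad N w S Q'"
  by (simp add: lindblad_def mm_add_left mm_add_right scal_def fun_eq_iff algebra_simps)

lemma lindblad_scal: "lindblad N w S (scal k Q) = scal k (lindblad N w S Q)"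
  by (simp add: lindblad_def mm_scal_left mm_scal_right) (simp add: scal_def fun_eq_iff algebra_simps)

text \<open>Makes the kernel closed under adjoints, which allows the reduction to Hermitian
  Q.\<close>

lemma adj_lindblad: "adj (lindblad N w S Q) = lindblad N w S (adj Q)"
  by (simp add: lindblad_def adj_scal adj_mm adj_diff adj_add mm_assoc add.commute)

text \<open>Let m be the largest point with a jump elsewhere. A jump from m to a point above m could
  be reversed, so that point would jump as well, against maximality. Hence all jumps away from m
  lead down, and the drift at m is negative.\<close>

lemma harmonic_no_jumps:
  fixes f :: "real \<Rightarrow> real \<Rightarrow> real"
  assumes E: "finite E"
    and nonneg: "\<And>x y. x \<in> E \<Longrightarrow> y \<in> E \<Longrightarrow> f x y \<ge> 0"
    and rev: "\<And>x y. x \<in> E \<Longrightarrow> y \<in> E \<Longrightarrow> f x y > 0 \<Longrightarrow> f y x > 0"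
    and harm: "\<And>x. x \<in> E \<Longrightarrow> (\<Sum>y\<in>E. (y - x) * f x y) = 0"
    and "x \<in> E" "y \<in> E" "x \<noteq> y"
  shows "f x y = 0"
proof (rule ccontr)
  assume "f x y \<noteq> 0"
  define B where "B = {x \<in> E. \<exists>y\<in>E. y \<noteq> x \<and> f x y > 0}"
  have "f x y > 0" using nonneg[OF \<open>x \<in> E\<close> \<open>y \<in> E\<close>] \<open>f x y \<noteq> 0\<close> by simp
  then have "x \<in> B" using \<open>x \<in> E\<close> \<open>y \<in> E\<close> \<open>x \<noteq> y\<close> unfolding B_def by (intro CollectI conjI bexI[of _ y]) simp_all
  moreover have finB: "finite B" using E by (simp add: B_def)
  ultimately have M: "Max B \<in> B" by (intro Max_in) auto
  define m where "m = Max B"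
  obtain y where y: "m \<in> E" "y \<in> E" "y \<noteq> m" "f m y > 0" using M by (auto simp: B_def m_def)
  have up: "z \<le> m" if "z \<in> E" "f m z > 0" for z
  proof (rule ccontr)
    assume "\<not> z \<le> m"
    with that y rev[of m z] have "z \<in> B" by (auto simp: B_def)
    with finB \<open>\<not> z \<le> m\<close> show False by (auto simp: m_def)
  qed
  have "(\<Sum>z\<in>E. (m - z) * f m z) > 0"
  proof (rule sum_pos2[OF E y(2)])
    show "(m - y) * f m y > 0" using up[OF y(2,4)] y by simp
    show "0 \<le> (m - z) * f m z" if "z \<in> E" for z
      using nonneg[OF y(1) that] up[OF that] by (cases "f m z = 0") auto
  qed
  moreover have "(\<Sum>z\<in>E. (m - z) * f m z) = - (\<Sum>z\<in>E. (z - m) * f m z)"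
    unfolding sum_negf[symmetric] by (rule sum.cong) (auto simp: algebra_simps)
  ultimately show False using harm[OF y(1)] by simp
qed

text \<open>Compress to the eigenspace of x. In the gain term Q is expanded as the sum of y P_y; in
  the loss terms Q acts as x and the identity is expanded as the sum of P_y. So the block P_y S P_x
  enters with the factor y - x.\<close>

lemma lindblad_spectral_trace:
  fixes Q S :: "('g::{finite,zero}) gop"
  assumes Q: "Q \<in> ops N" "adj Q = Q" and S: "S \<in> ops N"
  shows "tr N (mm N (spec_proj N Q x) (mm N (lindblad N w S Q) (spec_proj N Q x)))
    = of_real (w * (\<Sum>y\<in>eigvals N Q. (y - x) * hs N (mm N (spec_proj N Q y) (mm N S (spec_proj N Q x)))))"
proof -
  let ?E = "eigvals N Q" and ?P = "spec_proj N Q"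
  let ?W = "\<lambda>y. mm N (?P y) (mm N S (?P x))"
  note P = spec_proj_ops[OF Q] adj_spec_proj[OF Q] spec_proj_mm[OF Q] H_spec_proj[OF Q]
    spec_proj_H[OF Q] sum_spec_proj[OF Q]
  have W: "mm N (adj (?W y)) (?W y) = mm N (?P x) (mm N (adj S) (mm N (?P y) (mm N S (?P x))))" for y
  proof -
    have "mm N (?P y) (mm N (?P y) Z) = mm N (?P y) Z" for Z
      using P(3)[of y y] by (simp add: mm_assoc[symmetric])
    then show ?thesis by (simp add: adj_mm P mm_assoc)
  qed
  have res: "(\<Sum>y\<in>?E. ?P y) = idop N" by (rule P)
  have one: "(\<Sum>y\<in>?E. mm N (adj (?W y)) (?W y)) = mm N (?P x) (mm N (adj S) (mm N S (?P x)))"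
    using S P(1) unfolding W
    by (simp only: mm_sum_left[symmetric] mm_sum_right[symmetric] res) (simp add: idop_left ops_mm)
  have Qs: "Q = (\<Sum>y\<in>?E. scal (of_real y) (?P y))"
  proof -
    have "Q = mm N Q (\<Sum>y\<in>?E. ?P y)" by (simp add: res idop_right Q)
    then show ?thesis by (simp only: mm_sum_right P(4))
  qed
  have two: "(\<Sum>y\<in>?E. scal (of_real y) (mm N (adj (?W y)) (?W y))) = mm N (?P x) (mm N (adj S) (mm N Q (mm N S (?P x))))"
    unfolding W
    \<comment> \<open>The occurrence of Q to be replaced is the one between \<open>adj S\<close> and
      \<open>S\<close>; those inside the spectral projections must stay.\<close>
    by (subst (3) Qs) (simp only: mm_sum_left mm_sum_right mm_scal_left mm_scal_right)
  have QP: "mm N Q (?P x) = scal (of_real x) (?P x)" by (rule P)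
  have PQ: "mm N (?P x) (mm N Q Z) = scal (of_real x) (mm N (?P x) Z)" for Z
    by (simp add: mm_assoc[symmetric] P(5) mm_scal_left)
  have "mm N (?P x) (mm N (lindblad N w S Q) (?P x)) =
     scal (of_real w) (mm N (?P x) (mm N (adj S) (mm N Q (mm N S (?P x)))) -
       scal (of_real x) (mm N (?P x) (mm N (adj S) (mm N S (?P x)))))"
    by (simp add: lindblad_def mm_scal_left mm_scal_right mm_diff_left mm_diff_right mm_add_left mm_add_right mm_assoc QP PQ scal_add)
       (simp add: scal_def fun_eq_iff algebra_simps)
  also have "\<dots> = scal (of_real w) ((\<Sum>y\<in>?E. scal (of_real y) (mm N (adj (?W y)) (?W y)))
      - scal (of_real x) (\<Sum>y\<in>?E. mm N (adj (?W y)) (?W y)))"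
    by (simp only: one two)
  finally show ?thesis
    by (simp add: tr_scal tr_diff tr_sum tr_adj_mm sum_subtractf algebra_simps sum_distrib_left)
qed

text \<open>The states of the chain are the eigenvalues of Q, and f x y is the total weight of the
  jump blocks from x to y. The block of the adjoint jump from y to x is the adjoint of the block
  from x to y, so f x y and f y x vanish together, although their values may differ with the
  rates.\<close>

lemma lindblad_kernel_hermitian:
  fixes Q :: "('g::{finite,zero}) gop" and J :: "'j \<Rightarrow> 'g gop" and w :: "'j \<Rightarrow> real"
  assumes A: "finite A" and J: "\<And>a. a \<in> A \<Longrightarrow> J a \<in> ops N" and w: "\<And>a. a \<in> A \<Longrightarrow> w a > 0"
    and cl: "\<And>a. a \<in> A \<Longrightarrow> \<exists>b\<in>A. J b = adj (J a)"
    and Q: "Q \<in> ops N" "adj Q = Q"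
    and ker: "(\<Sum>a\<in>A. lindblad N (w a) (J a) Q) = 0"
    and a: "a \<in> A"
  shows "commutes N Q (J a)"
proof -
  let ?E = "eigvals N Q" and ?P = "spec_proj N Q"
  note P = spec_proj_ops[OF Q] adj_spec_proj[OF Q] H_spec_proj[OF Q] spec_proj_H[OF Q] sum_spec_proj[OF Q]
  have finE: "finite ?E" by (rule finite_eigvals[OF Q])
  define f where "f x y = (\<Sum>a\<in>A. w a * hs N (mm N (?P y) (mm N (J a) (?P x))))" for x y
  have f_nonneg: "f x y \<ge> 0" for x y
    unfolding f_def by (intro sum_nonneg mult_nonneg_nonneg hs_nonneg) (use w in force)
  have W_ops: "mm N (?P y) (mm N (J a) (?P x)) \<in> ops N" if "a \<in> A" for a x y
    using J[OF that] P by (intro ops_mm) auto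
  have f_zero: "f x y = 0 \<longleftrightarrow> (\<forall>a\<in>A. mm N (?P y) (mm N (J a) (?P x)) = 0)" for x y
  proof -
    have "f x y = 0 \<longleftrightarrow> (\<forall>a\<in>A. w a * hs N (mm N (?P y) (mm N (J a) (?P x))) = 0)"
      unfolding f_def using A w
      by (intro sum_nonneg_eq_0_iff mult_nonneg_nonneg hs_nonneg) (auto intro: less_imp_le)
    also have "\<dots> \<longleftrightarrow> (\<forall>a\<in>A. mm N (?P y) (mm N (J a) (?P x)) = 0)"
      using w by (intro ball_cong refl) (force simp: hs_eq_0_iff[OF W_ops])
    finally show ?thesis .
  qed
  have f_rev: "f y x > 0" if "f x y > 0" for x y
  proof -
    from that obtain a where a: "a \<in> A" "mm N (?P y) (mm N (J a) (?P x)) \<noteq> 0"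
      using f_zero[of x y] by auto
    obtain b where b: "b \<in> A" "J b = adj (J a)" using cl[OF a(1)] by blast
    have "adj (mm N (?P x) (mm N (J b) (?P y))) = mm N (?P y) (mm N (J a) (?P x))"
      by (simp add: adj_mm b P mm_assoc)
    with a have "mm N (?P x) (mm N (J b) (?P y)) \<noteq> 0" by (metis adj_zero)
    with b have "f y x \<noteq> 0" using f_zero by blast
    with f_nonneg[of y x] show ?thesis by simp
  qed
  have harm: "(\<Sum>y\<in>?E. (y - x) * f x y) = 0" for x
  proof -
    have "complex_of_real (\<Sum>y\<in>?E. (y - x) * f x y) =
      (\<Sum>a\<in>A. of_real (w a * (\<Sum>y\<in>?E. (y - x) * hs N (mm N (?P y) (mm N (J a) (?P x))))))"
      unfolding f_def of_real_sum[symmetric] sum_distrib_left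
      by (subst sum.swap) (simp add: mult_ac)
    also have "\<dots> = (\<Sum>a\<in>A. tr N (mm N (?P x) (mm N (lindblad N (w a) (J a) Q) (?P x))))"
      using J by (intro sum.cong refl lindblad_spectral_trace[OF Q, symmetric])
    also have "\<dots> = tr N (mm N (?P x) (mm N (\<Sum>a\<in>A. lindblad N (w a) (J a) Q) (?P x)))"
      by (simp only: mm_sum_left mm_sum_right tr_sum)
    also have "\<dots> = 0" by (simp add: ker)
    finally show ?thesis by (simp only: of_real_eq_0_iff)
  qed
  have off: "mm N (?P y) (mm N (J a) (?P x)) = 0" if "x \<in> ?E" "y \<in> ?E" "x \<noteq> y" for x y
  proof -
    have "f x y = 0"
      by (rule harmonic_no_jumps[OF finE]) (use f_nonneg f_rev harm that in auto)
    with a show ?thesis by (simp add: f_zero)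
  qed
  \<comment> \<open>In this block the two products carry the factors y and x: they agree for x = y,
    and otherwise the block vanishes.\<close>
  have "mm N (?P y) (mm N (mm N Q (J a)) (?P x)) = mm N (?P y) (mm N (mm N (J a) Q) (?P x))"
    if "x \<in> ?E" "y \<in> ?E" for x y
  proof -
    have "mm N (?P y) (mm N (mm N Q (J a)) (?P x)) = scal (of_real y) (mm N (?P y) (mm N (J a) (?P x)))"
      using P(4)[of y] by (simp add: mm_assoc[symmetric] mm_scal_left)
    moreover have "mm N (?P y) (mm N (mm N (J a) Q) (?P x)) = scal (of_real x) (mm N (?P y) (mm N (J a) (?P x)))"
      by (simp add: mm_assoc P mm_scal_right)
    ultimately show ?thesis using off[OF that] by (cases "x = y") auto
  qed
  then have eq: "(\<Sum>y\<in>?E. \<Sum>x\<in>?E. mm N (?P y) (mm N (mm N Q (J a)) (?P x))) =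
     (\<Sum>y\<in>?E. \<Sum>x\<in>?E. mm N (?P y) (mm N (mm N (J a) Q) (?P x)))"
    by (intro sum.cong refl)
  have res: "(\<Sum>y\<in>?E. \<Sum>x\<in>?E. mm N (?P y) (mm N Z (?P x))) = Z" if "Z \<in> ops N" for Z
    using that by (simp only: mm_sum_right[symmetric] mm_sum_left[symmetric] P(5)) (simp add: idop_left idop_right)
  show ?thesis
    using eq J[OF a] Q unfolding commutes_def by (simp add: res ops_mm)
qed

text \<open>The kernel is complex-linear and closed under adjoints, so Q can be recovered from two
  Hermitian elements of the kernel.\<close>

lemma lindblad_kernel:
  fixes Q :: "('g::{finite,zero}) gop" and J :: "'j \<Rightarrow> 'g gop" and w :: "'j \<Rightarrow> real"
  assumes A: "finite A" and J: "\<And>a. a \<in> A \<Longrightarrow> J a \<in> ops N" and w: "\<And>a. a \<in> A \<Longrightarrow> w a > 0"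
    and cl: "\<And>a. a \<in> A \<Longrightarrow> \<exists>b\<in>A. J b = adj (J a)"
    and Q: "Q \<in> ops N"
  shows "(\<Sum>a\<in>A. lindblad N (w a) (J a) Q) = 0 \<longleftrightarrow> (\<forall>a\<in>A. commutes N Q (J a))"
proof
  assume "\<forall>a\<in>A. commutes N Q (J a)"
  then have "lindblad N (w a) (J a) Q = 0" if "a \<in> A" for a
    using that cl[OF that] by (intro lindblad_commuting) auto
  then show "(\<Sum>a\<in>A. lindblad N (w a) (J a) Q) = 0"
    by (rule sum.neutral[OF ballI])
next
  assume ker: "(\<Sum>a\<in>A. lindblad N (w a) (J a) Q) = 0"
  have ker': "(\<Sum>a\<in>A. lindblad N (w a) (J a) (adj Q)) = 0"
    using arg_cong[OF ker, of adj] by (simp add: adj_sum adj_lindblad)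
  have kerlin: "(\<Sum>a\<in>A. lindblad N (w a) (J a) (scal s Q + scal t (adj Q))) = 0" for s t
    by (simp add: lindblad_add lindblad_scal sum.distrib scal_sum[symmetric] ker ker')
  show "\<forall>a\<in>A. commutes N Q (J a)"
  proof
    fix a assume a: "a \<in> A"
    let ?X = "scal 1 Q + scal 1 (adj Q)" and ?Y = "scal \<i> Q + scal (- \<i>) (adj Q)"
    have X: "commutes N ?X (J a)"
      by (rule lindblad_kernel_hermitian[OF A J w cl _ _ kerlin a])
         (simp_all add: ops_add ops_scal ops_adj Q adj_add adj_scal add.commute)
    have Y: "commutes N ?Y (J a)"
      by (rule lindblad_kernel_hermitian[OF A J w cl _ _ kerlin a])
         (simp_all add: ops_add ops_scal ops_adj Q adj_add adj_scal add.commute)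
    have "Q = scal (1/2) ?X + scal (- \<i> / 2) ?Y"
      by (simp add: scal_def fun_eq_iff algebra_simps)
    then show "commutes N Q (J a)"
      using commutes_add[OF commutes_scal commutes_scal, OF commutes_sym[OF X] commutes_sym[OF Y]]
      by (metis commutes_sym)
  qed
qed

section \<open>Operators at a single edge\<close>

declare split_paired_All [simp del] split_paired_Ex [simp del]

section \<open>Matrix entries of single-edge operators\<close>

lemma confs_upd: "e \<in> lattice N \<Longrightarrow> c(e := a) \<in> confs N \<longleftrightarrow> c \<in> confs N"
  by (auto simp: confs_def)

text \<open>\<open>tensor\<close> compares configurations on the lattice only; as they vanish off
  it, the comparison may run over all edges.\<close>

lemma confs_eq_off:
  assumes "c \<in> confs N" "c' \<in> confs N"
  shows "(\<forall>e'\<in>lattice N - V. c e' = c' e') \<longleftrightarrow> (\<forall>e'. e' \<notin> V \<longrightarrow> c e' = c' e')"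
proof (intro iffI allI impI)
  fix e' assume "\<forall>e'\<in>lattice N - V. c e' = c' e'" "e' \<notin> V"
  then show "c e' = c' e'"
    using assms by (cases "e' \<in> lattice N") (simp_all add: confs_def)
qed simp

lemma at_edge_apply:
  "at_edge N e X c c' = (if c \<in> confs N \<and> c' \<in> confs N \<and> (\<forall>e'. e' \<noteq> e \<longrightarrow> c e' = c' e')
     then X (c e) (c' e) else 0)"
  using confs_eq_off[of c N c' "{e}"] by (auto simp: at_edge_def tensor_def)

lemma at_edge_ops: "at_edge N e X \<in> ops N"
  by (simp add: ops_def at_edge_apply)

lemma adj_at_edge: "adj (at_edge N e X) = at_edge N e (sadj X)"
  by (intro ext) (auto simp: adj_def at_edge_apply sadj_def)

text \<open>Only configurations that agree with c' away from e meet a nonzero entry, and these are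
  indexed by their value at e.\<close>

lemma mm_at_edge_right:
  fixes Q :: "('g::{finite,zero}) gop"
  assumes e: "e \<in> lattice N" and c': "c' \<in> confs N"
  shows "mm N Q (at_edge N e X) c c' = (\<Sum>a\<in>UNIV. Q c (c'(e := a)) * X a (c' e))"
proof -
  have inj: "inj (\<lambda>a. c'(e := a))" by (auto simp: inj_def dest: fun_upd_eqD)
  have "mm N Q (at_edge N e X) c c' = (\<Sum>d\<in>(\<lambda>a. c'(e := a)) ` UNIV. Q c d * at_edge N e X d c')"
    unfolding mm_def
  proof (rule sum.mono_neutral_right[OF finite_confs])
    show "(\<lambda>a. c'(e := a)) ` UNIV \<subseteq> confs N" using e c' by (auto simp: confs_upd)
    show "\<forall>d\<in>confs N - (\<lambda>a. c'(e := a)) ` UNIV. Q c d * at_edge N e X d c' = 0"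
    proof
      fix d assume d: "d \<in> confs N - (\<lambda>a. c'(e := a)) ` UNIV"
      have "\<not> (\<forall>e'. e' \<noteq> e \<longrightarrow> d e' = c' e')"
      proof
        assume "\<forall>e'. e' \<noteq> e \<longrightarrow> d e' = c' e'"
        then have "d = c'(e := d e)" by (intro ext) simp
        with d show False by blast
      qed
      then show "Q c d * at_edge N e X d c' = 0" unfolding at_edge_apply by auto
    qed
  qed
  also have "\<dots> = (\<Sum>a\<in>UNIV. Q c (c'(e := a)) * at_edge N e X (c'(e := a)) c')"
    using inj by (simp add: sum.reindex)
  also have "\<dots> = (\<Sum>a\<in>UNIV. Q c (c'(e := a)) * X a (c' e))"
    using e c' by (simp add: at_edge_apply confs_upd)
  finally show ?thesis .
qed

lemma mm_at_edge_left:
  fixes Q :: "('g::{finite,zero}) gop"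
  assumes e: "e \<in> lattice N" and c: "c \<in> confs N"
  shows "mm N (at_edge N e X) Q c c' = (\<Sum>a\<in>UNIV. X (c e) a * Q (c(e := a)) c')"
proof -
  have "mm N (at_edge N e X) Q c c' = cnj (mm N (adj Q) (at_edge N e (sadj X)) c' c)"
    using adj_mm[of N "adj Q" "at_edge N e (sadj X)"]
    by (simp add: adj_at_edge fun_eq_iff) (simp add: adj_def sadj_def)
  then show ?thesis
    by (simp add: mm_at_edge_right[OF assms] adj_def sadj_def mult.commute)
qed

text \<open>For operators in \<open>ops N\<close>, this is membership in 1_e (x) B(rest), read off
  from matrix entries; k depends on the two configurations away from e. It spares an explicit tensor
  factorisation.\<close>

definition blind :: "nat \<Rightarrow> edge \<Rightarrow> ('g::zero) gop \<Rightarrow> bool" where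
  "blind N e Q \<longleftrightarrow> (\<forall>c\<in>confs N. \<forall>c'\<in>confs N. \<exists>k. \<forall>a b.
     Q (c(e := a)) (c'(e := b)) = (if a = b then k else 0))"

text \<open>Freezing both configurations away from e leaves a one-edge slice of Q, which commutes
  with the jump operators because Q does, and is therefore a scalar.\<close>

lemma blind_if_commutes:
  fixes Q :: "('g::{finite,zero}) gop" and S :: "'i \<Rightarrow> 'g sop"
  assumes e: "e \<in> lattice N"
    and irr: "\<And>X :: 'g sop. (\<forall>i. smult_site X (S i) = smult_site (S i) X) \<Longrightarrow> \<exists>k. X = (\<lambda>a b. k * sid a b)"
    and comm: "\<And>i. commutes N Q (at_edge N e (S i))"
  shows "blind N e Q"
  unfolding blind_def
proof (intro ballI)
  fix c c' :: "'g conf" assume c: "c \<in> confs N" "c' \<in> confs N"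
  define X where "X a b = Q (c(e := a)) (c'(e := b))" for a b
  have "smult_site X (S i) = smult_site (S i) X" for i
  proof (intro ext)
    fix a b
    have "mm N Q (at_edge N e (S i)) (c(e := a)) (c'(e := b)) = mm N (at_edge N e (S i)) Q (c(e := a)) (c'(e := b))"
      using comm[of i] by (simp add: commutes_def)
    then show "smult_site X (S i) a b = smult_site (S i) X a b"
      using e c by (simp add: mm_at_edge_right mm_at_edge_left confs_upd smult_site_def X_def)
  qed
  then obtain k where "X = (\<lambda>a b. k * sid a b)" using irr by blast
  then have "X a b = (if a = b then k else 0)" for a b by (simp add: sid_def)
  then show "\<exists>k. \<forall>a b. Q (c(e := a)) (c'(e := b)) = (if a = b then k else 0)"
    unfolding X_def by blast
qed

lemma blind_commutes:
  fixes Q :: "('g::{finite,zero}) gop"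
  assumes e: "e \<in> lattice N" and Q: "Q \<in> ops N" "blind N e Q"
  shows "commutes N Q (at_edge N e X)"
  unfolding commutes_def
proof (intro ext)
  fix c c' :: "'g conf"
  show "mm N Q (at_edge N e X) c c' = mm N (at_edge N e X) Q c c'"
  proof (cases "c \<in> confs N \<and> c' \<in> confs N")
    case True
    then obtain k where k: "\<And>a b. Q (c(e := a)) (c'(e := b)) = (if a = b then k else 0)"
      using Q(2) unfolding blind_def by blast
    have 1: "Q c (c'(e := b)) = (if c e = b then k else 0)" for b using k[of "c e" b] by simp
    have 2: "Q (c(e := a)) c' = (if a = c' e then k else 0)" for a using k[of a "c' e"] by simp
    show ?thesis
      using True e by (simp add: mm_at_edge_right mm_at_edge_left 1 2 if_distrib[of "\<lambda>x. x * _"]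
          if_distrib[of "\<lambda>x. _ * x"] cong: if_cong)
  next
    case False
    then show ?thesis
      using ops_mm[OF Q(1) at_edge_ops] ops_mm[OF at_edge_ops Q(1)] by (auto simp: ops_def)
  qed
qed

text \<open>For the converse the witness X is Q itself, evaluated at configurations set to 0 on R;
  blindness allows the edges of R to be reset one by one.\<close>

lemma id_tensor_iff_blind:
  fixes Q :: "('g::{finite,zero}) gop"
  assumes R: "R \<subseteq> lattice N"
  shows "Q \<in> id_tensor N R \<longleftrightarrow> Q \<in> ops N \<and> (\<forall>e\<in>R. blind N e Q)"
proof
  assume Q: "Q \<in> id_tensor N R"
  then obtain X where X: "\<And>c c'. c \<in> confs N \<Longrightarrow> c' \<in> confs N \<Longrightarrow>
      Q c c' = (if (\<forall>e\<in>R. c e = c' e)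
                then X (\<lambda>e. if e \<in> R then 0 else c e) (\<lambda>e. if e \<in> R then 0 else c' e)
                else 0)"
    unfolding id_tensor_def by blast
  have "blind N e Q" if e: "e \<in> R" for e
    unfolding blind_def
  proof (intro ballI)
    fix c c' :: "'g conf" assume c: "c \<in> confs N" "c' \<in> confs N"
    have zero: "(\<lambda>e'. if e' \<in> R then 0 else (c(e := a)) e') = (\<lambda>e'. if e' \<in> R then 0 else c e')" for a and c :: "'g conf"
      using e by auto
    have agree: "(\<forall>e'\<in>R. (c(e := a)) e' = (c'(e := b)) e') \<longleftrightarrow> a = b \<and> (\<forall>e'\<in>R - {e}. c e' = c' e')" for a b
      using e by auto
    have el: "e \<in> lattice N" using e R by blast
    show "\<exists>k. \<forall>a b. Q (c(e := a)) (c'(e := b)) = (if a = b then k else 0)"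
      by (rule exI[of _ "if \<forall>e'\<in>R - {e}. c e' = c' e' then X (\<lambda>e'. if e' \<in> R then 0 else c e')
          (\<lambda>e'. if e' \<in> R then 0 else c' e') else 0"], intro allI, subst X)
        (simp_all only: confs_upd[OF el] c zero agree, simp)
  qed
  with Q show "Q \<in> ops N \<and> (\<forall>e\<in>R. blind N e Q)" by (auto simp: id_tensor_def)
next
  assume Q: "Q \<in> ops N \<and> (\<forall>e\<in>R. blind N e Q)"
  have finR: "finite R" using R finite_lattice finite_subset by blast
  have agree: "Q c c' = Q (\<lambda>e. if e \<in> R' then 0 else c e) (\<lambda>e. if e \<in> R' then 0 else c' e)"
    if "R' \<subseteq> R" "c \<in> confs N" "c' \<in> confs N" "\<forall>e\<in>R'. c e = c' e" for R' c c'
  proof -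
    have "finite R'" using that(1) finR finite_subset by blast
    then show ?thesis using that
    proof (induction R' arbitrary: c c' rule: finite_induct)
      case (insert e F)
      obtain k where k: "\<And>a b. Q (c(e := a)) (c'(e := b)) = (if a = b then k else 0)"
        using Q insert.prems unfolding blind_def by blast
      have "Q c c' = (if c e = c' e then k else 0)" using k[of "c e" "c' e"] unfolding fun_upd_triv .
      then have "Q c c' = k" using insert.prems by simp
      also have "k = Q (c(e := 0)) (c'(e := 0))" using k[of 0 0] by simp
      also have "\<dots> = Q (\<lambda>e'. if e' \<in> F then 0 else (c(e := 0)) e') (\<lambda>e'. if e' \<in> F then 0 else (c'(e := 0)) e')"
        using insert.prems R by (intro insert.IH) (auto simp: confs_def)
      also have "(\<lambda>e'. if e' \<in> F then 0 else (c(e := 0)) e') = (\<lambda>e'. if e' \<in> insert e F then 0 else c e')"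
        by auto
      also have "(\<lambda>e'. if e' \<in> F then 0 else (c'(e := 0)) e') = (\<lambda>e'. if e' \<in> insert e F then 0 else c' e')"
        by auto
      finally show ?case .
    qed simp
  qed
  have disagree: "Q c c' = 0" if c: "c \<in> confs N" "c' \<in> confs N" "\<not> (\<forall>e\<in>R. c e = c' e)" for c c'
  proof -
    obtain e where e: "e \<in> R" "c e \<noteq> c' e" using c(3) by blast
    obtain k where "\<And>a b. Q (c(e := a)) (c'(e := b)) = (if a = b then k else 0)"
      using Q e c unfolding blind_def by blast
    from this[of "c e" "c' e"] e show ?thesis by simp
  qed
  have "\<forall>c\<in>confs N. \<forall>c'\<in>confs N. Q c c' = (if (\<forall>e\<in>R. c e = c' e)
                then Q (\<lambda>e. if e \<in> R then 0 else c e) (\<lambda>e. if e \<in> R then 0 else c' e)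
                else 0)"
  proof (intro ballI)
    fix c c' :: "'g conf" assume c: "c \<in> confs N" "c' \<in> confs N"
    show "Q c c' = (if (\<forall>e\<in>R. c e = c' e)
                then Q (\<lambda>e. if e \<in> R then 0 else c e) (\<lambda>e. if e \<in> R then 0 else c' e)
                else 0)"
    proof (cases "\<forall>e\<in>R. c e = c' e")
      case True
      show ?thesis unfolding if_P[OF True] by (rule agree[OF order_refl c True])
    next
      case False
      show ?thesis unfolding if_not_P[OF False] by (rule disagree[OF c False])
    qed
  qed
  with Q show "Q \<in> id_tensor N R"
    unfolding id_tensor_def by blast
qed

section \<open>Twirling\<close>

text \<open>Two families, because the shift average conjugates by L^g and its inverse, whereas
  dephasing has the same projection on both sides. The normalisation is left out and reappears as
  the scalar \<kappa>.\<close>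

definition twirl :: "nat \<Rightarrow> ('j::finite \<Rightarrow> ('g::zero) gop) \<Rightarrow> ('j \<Rightarrow> 'g gop) \<Rightarrow> 'g gop \<Rightarrow> 'g gop" where
  "twirl N U V Y = (\<Sum>j\<in>UNIV. mm N (U j) (mm N Y (V j)))"

lemma twirl_add: "twirl N U V (X + Y) = twirl N U V X + twirl N U V Y"
  by (simp add: twirl_def mm_add_left mm_add_right sum.distrib)
lemma twirl_diff: "twirl N U V (X - Y) = twirl N U V X - twirl N U V Y"
  by (simp add: twirl_def mm_diff_left mm_diff_right sum_subtractf)
lemma twirl_uminus: "twirl N U V (- Y) = - twirl N U V Y"
  by (simp add: twirl_def mm_minus_left mm_minus_right sum_negf)
lemma twirl_sum: "twirl N U V (\<Sum>i\<in>I. F i) = (\<Sum>i\<in>I. twirl N U V (F i))"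
  unfolding twirl_def by (simp only: mm_sum_left mm_sum_right) (rule sum.swap)

lemma commutes_twirl:
  assumes "\<And>j. commutes N Q (U j)" "\<And>j. commutes N Q (V j)" "commutes N Q Y"
  shows "commutes N Q (twirl N U V Y)"
  unfolding twirl_def using assms by (intro commutes_sum commutes_mm)

text \<open>Since Q passes through U and V, the commutator of Q with the twirl of H is the twirl of
  [Q,H]. Since [Q,H] passes through U, this twirl is \<kappa> [Q,H]. So Q commutes with the
  difference between \<kappa> H and the twirl of H.\<close>

lemma commutes_twirl_defect:
  fixes Q H :: "('g::{finite,zero}) gop"
  assumes U: "\<And>j. commutes N Q (U j)" and V: "\<And>j. commutes N Q (V j)"
    and K: "\<And>j. commutes N (mm N Q H - mm N H Q) (U j)"
    and ops: "Q \<in> ops N" "H \<in> ops N"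
    and one: "(\<Sum>j\<in>UNIV. mm N (U j) (V j)) = scal \<kappa> (idop N)"
  shows "commutes N Q (scal \<kappa> H - twirl N U V H)"
proof -
  let ?K = "mm N Q H - mm N H Q"
  have "mm N Q (twirl N U V H) = twirl N U V (mm N Q H)"
    unfolding twirl_def mm_sum_right
    using U by (intro sum.cong refl) (simp add: commutes_def mm_assoc[symmetric])
  moreover have "mm N (twirl N U V H) Q = twirl N U V (mm N H Q)"
    unfolding twirl_def mm_sum_left
    using V by (intro sum.cong refl) (simp add: commutes_def mm_assoc)
  moreover have "twirl N U V ?K = scal \<kappa> ?K"
  proof -
    have "twirl N U V ?K = (\<Sum>j\<in>UNIV. mm N ?K (mm N (U j) (V j)))"
      unfolding twirl_def
    proof (rule sum.cong[OF refl])
      fix j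
      have "mm N (U j) (mm N ?K (V j)) = mm N (mm N (U j) ?K) (V j)" by (rule mm_assoc[symmetric])
      also have "mm N (U j) ?K = mm N ?K (U j)" by (rule K[unfolded commutes_def, symmetric])
      also have "mm N (mm N ?K (U j)) (V j) = mm N ?K (mm N (U j) (V j))" by (rule mm_assoc)
      finally show "mm N (U j) (mm N ?K (V j)) = mm N ?K (mm N (U j) (V j))" .
    qed
    also have "\<dots> = mm N ?K (scal \<kappa> (idop N))"
      unfolding one[symmetric] mm_sum_right ..
    also have "\<dots> = scal \<kappa> ?K"
      using ops by (simp add: mm_scal_right idop_right ops_diff ops_mm)
    finally show ?thesis .
  qed
  ultimately show ?thesis
    unfolding commutes_def
    by (simp add: mm_diff_left mm_diff_right mm_scal_left mm_scal_right twirl_diff scal_diff)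
       (simp add: algebra_simps)
qed

text \<open>Suppose every edge of R touches both v1 and v2 or neither. Connectivity through D then
  spreads the pair {v1, v2} from e to all of R. Distinct edges sharing a D'-cell have different
  pairs, so connectivity through D' leaves no second edge in R. Abstract cells cover stars and
  plaquettes alike.\<close>

lemma crossing_edge:
  fixes D D' :: "vertex \<Rightarrow> edge set" and W :: "vertex set"
  assumes conn: "\<forall>e\<in>R. \<forall>e'\<in>R. (e, e') \<in> {(e, e'). e \<in> R \<and> e' \<in> R \<and> (\<exists>v\<in>W. e \<in> D v \<and> e' \<in> D v)}\<^sup>*"
    and conn': "\<forall>e\<in>R. \<forall>e'\<in>R. (e, e') \<in> {(e, e'). e \<in> R \<and> e' \<in> R \<and> (\<exists>v\<in>W. e \<in> D' v \<and> e' \<in> D' v)}\<^sup>*"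
    and two: "\<And>e. e \<in> R \<Longrightarrow> \<exists>v1 v2. {v \<in> W. e \<in> D v} = {v1, v2}"
    and sep: "\<And>e e' v. v \<in> W \<Longrightarrow> e \<in> D' v \<Longrightarrow> e' \<in> D' v \<Longrightarrow> e \<in> R \<Longrightarrow> e' \<in> R \<Longrightarrow> e \<noteq> e' \<Longrightarrow>
       {v \<in> W. e \<in> D v} \<noteq> {v \<in> W. e' \<in> D v}"
    and card: "card R \<ge> 2"
    and e: "e \<in> R" "{v \<in> W. e \<in> D v} = {v1, v2}" "v1 \<noteq> v2"
  shows "\<exists>e'\<in>R. (e' \<in> D v1) \<noteq> (e' \<in> D v2)"
proof (rule ccontr)
  assume "\<not> ?thesis"
  then have same: "\<And>e'. e' \<in> R \<Longrightarrow> e' \<in> D v1 \<longleftrightarrow> e' \<in> D v2" by blast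
  have vW: "v1 \<in> W" "v2 \<in> W" using e(2) by auto
  have all: "{v \<in> W. e' \<in> D v} = {v1, v2}" if "e' \<in> R" for e'
  proof -
    have "(e, e') \<in> {(e, e'). e \<in> R \<and> e' \<in> R \<and> (\<exists>v\<in>W. e \<in> D v \<and> e' \<in> D v)}\<^sup>*"
      using conn e(1) that by blast
    then show ?thesis
    proof (induction rule: rtrancl_induct)
      case base
      show ?case by (rule e(2))
    next
      case (step y z)
      then obtain v where v: "v \<in> W" "y \<in> D v" "z \<in> D v" "z \<in> R" by blast
      then have "v \<in> {v1, v2}" using step.IH by blast
      then have "z \<in> D v1" "z \<in> D v2" using v same[OF v(4)] by auto
      moreover obtain u1 u2 where u: "{v \<in> W. z \<in> D v} = {u1, u2}" using two[OF v(4)] by blast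
      ultimately have "v1 \<in> {u1, u2}" "v2 \<in> {u1, u2}" using vW by blast+
      then show ?case using e(3) u by auto
    qed
  qed
  have "\<not> R \<subseteq> {e}" using card card_mono[of "{e}" R] by auto
  then obtain e' where e': "e' \<in> R" "e' \<noteq> e" by blast
  have "(e, e') \<in> {(e, e'). e \<in> R \<and> e' \<in> R \<and> (\<exists>v\<in>W. e \<in> D' v \<and> e' \<in> D' v)}\<^sup>*"
    using conn' e(1) e'(1) by blast
  then have "e' = e"
  proof (induction rule: rtrancl_induct)
    case (step y z)
    then obtain v where v: "v \<in> W" "y \<in> D' v" "z \<in> D' v" "y \<in> R" "z \<in> R" by blast
    have "y = z"
    proof (rule ccontr)
      assume "y \<noteq> z"
      from sep[OF v this] all[OF v(4)] all[OF v(5)] show False by simp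
    qed
    with step.IH show ?case by simp
  qed simp
  with e' show False by simp
qed

text \<open>Twirling the Hamiltonian at an edge of R replaces the two cell terms meeting that edge by
  constants, so Q commutes with their sum; twirling this sum at an edge meeting only one of the two
  cells separates them.\<close>

lemma commutes_cell_terms:
  fixes Y Z :: "vertex \<Rightarrow> ('g::{finite,zero}) gop" and U V :: "edge \<Rightarrow> 'j::finite \<Rightarrow> 'g gop"
    and D D' :: "vertex \<Rightarrow> edge set"
  assumes W: "finite W" and H: "H = - (\<Sum>v\<in>W. Y v) - (\<Sum>v\<in>W. Z v)"
    and ops: "Q \<in> ops N" "H \<in> ops N"
    and U: "\<And>e j. e \<in> R \<Longrightarrow> commutes N Q (U e j)" and V: "\<And>e j. e \<in> R \<Longrightarrow> commutes N Q (V e j)"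
    and K: "\<And>e j. e \<in> R \<Longrightarrow> commutes N (mm N Q H - mm N H Q) (U e j)"
    and one: "\<And>e. e \<in> R \<Longrightarrow> (\<Sum>j\<in>UNIV. mm N (U e j) (V e j)) = scal \<kappa> (idop N)"
    and \<kappa>: "\<kappa> \<noteq> 0"
    and Z: "\<And>e v. e \<in> R \<Longrightarrow> v \<in> W \<Longrightarrow> twirl N (U e) (V e) (Z v) = scal \<kappa> (Z v)"
    and Y0: "\<And>e v. e \<in> R \<Longrightarrow> v \<in> W \<Longrightarrow> e \<notin> D v \<Longrightarrow> twirl N (U e) (V e) (Y v) = scal \<kappa> (Y v)"
    and Y1: "\<And>e v. e \<in> R \<Longrightarrow> v \<in> W \<Longrightarrow> e \<in> D v \<Longrightarrow> twirl N (U e) (V e) (Y v) = scal \<mu> (idop N)"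
    and conn: "\<forall>e\<in>R. \<forall>e'\<in>R. (e, e') \<in> {(e, e'). e \<in> R \<and> e' \<in> R \<and> (\<exists>v\<in>W. e \<in> D v \<and> e' \<in> D v)}\<^sup>*"
    and conn': "\<forall>e\<in>R. \<forall>e'\<in>R. (e, e') \<in> {(e, e'). e \<in> R \<and> e' \<in> R \<and> (\<exists>v\<in>W. e \<in> D' v \<and> e' \<in> D' v)}\<^sup>*"
    and two: "\<And>e. e \<in> R \<Longrightarrow> \<exists>v1 v2. v1 \<noteq> v2 \<and> {v \<in> W. e \<in> D v} = {v1, v2}"
    and sep: "\<And>e e' v. v \<in> W \<Longrightarrow> e \<in> D' v \<Longrightarrow> e' \<in> D' v \<Longrightarrow> e \<in> R \<Longrightarrow> e' \<in> R \<Longrightarrow> e \<noteq> e' \<Longrightarrow>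
       {v \<in> W. e \<in> D v} \<noteq> {v \<in> W. e' \<in> D v}"
    and card: "card R \<ge> 2"
    and v: "v \<in> W" "D v \<inter> R \<noteq> {}"
  shows "commutes N Q (Y v)"
proof -
  obtain e where e: "e \<in> R" "e \<in> D v" using v by blast
  obtain v1 v2 where v12: "v1 \<noteq> v2" "{v \<in> W. e \<in> D v} = {v1, v2}" using two[OF e(1)] by blast
  have vW: "v1 \<in> W" "v2 \<in> W" "e \<in> D v1" "e \<in> D v2" using v12(2) by auto
  have unscal: "commutes N Q X" if "commutes N Q (scal \<kappa> X)" for X
    using commutes_scal[OF that, of "1 / \<kappa>"] \<kappa> by simp
  have id: "commutes N Q (scal k (idop N))" for k
    by (intro commutes_scal commutes_idop ops)
  \<comment> \<open>Terms that the twirl merely multiplies by \<kappa> drop out of the difference,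
    so only the two cells containing e are left.\<close>
  have defect: "scal \<kappa> H - twirl N (U e) (V e) H =
     - (\<Sum>v\<in>W. scal \<kappa> (Y v) - twirl N (U e) (V e) (Y v)) - (\<Sum>v\<in>W. scal \<kappa> (Z v) - twirl N (U e) (V e) (Z v))"
    unfolding H twirl_diff twirl_uminus twirl_sum scal_diff sum_subtractf scal_sum[symmetric]
    by (simp add: scal_def fun_eq_iff algebra_simps)
  have defect_Z: "(\<Sum>v\<in>W. scal \<kappa> (Z v) - twirl N (U e) (V e) (Z v)) = 0"
    using Z[OF e(1)] by (intro sum.neutral ballI) simp
  have defect_Y: "(\<Sum>v\<in>W. scal \<kappa> (Y v) - twirl N (U e) (V e) (Y v)) =
      (\<Sum>v\<in>{v1, v2}. scal \<kappa> (Y v) - twirl N (U e) (V e) (Y v))"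
  proof (rule sum.mono_neutral_right[OF W])
    show "\<forall>v\<in>W - {v1, v2}. scal \<kappa> (Y v) - twirl N (U e) (V e) (Y v) = 0"
    proof
      fix v assume "v \<in> W - {v1, v2}"
      then have "v \<in> W" "e \<notin> D v" using v12(2) by blast+
      then show "scal \<kappa> (Y v) - twirl N (U e) (V e) (Y v) = 0" using Y0[OF e(1)] by simp
    qed
  qed (use vW in auto)
  \<comment> \<open>Each of the two cells is averaged to \<mu>, whence 2 \<mu>.\<close>
  have defect_Y12: "(\<Sum>v\<in>{v1, v2}. scal \<kappa> (Y v) - twirl N (U e) (V e) (Y v)) =
      scal \<kappa> (Y v1 + Y v2) - scal (2 * \<mu>) (idop N)"
    using v12(1) Y1[OF e(1)] vW by (simp add: scal_def fun_eq_iff algebra_simps)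
  have "commutes N Q (- (scal \<kappa> (Y v1 + Y v2) - scal (2 * \<mu>) (idop N)))"
    using commutes_twirl_defect[OF U[OF e(1)] V[OF e(1)] K[OF e(1)] ops one[OF e(1)]]
    unfolding defect defect_Z defect_Y defect_Y12 diff_zero .
  from commutes_diff[OF id[of "2 * \<mu>"] this]
  have "commutes N Q (scal \<kappa> (Y v1 + Y v2))" by simp
  then have sum: "commutes N Q (Y v1 + Y v2)" by (rule unscal)
  obtain e' where e': "e' \<in> R" "(e' \<in> D v1) \<noteq> (e' \<in> D v2)"
  proof -
    have two': "\<exists>v1 v2. {v \<in> W. e \<in> D v} = {v1, v2}" if "e \<in> R" for e
      using two[OF that] by blast
    have "\<exists>e'\<in>R. (e' \<in> D v1) \<noteq> (e' \<in> D v2)"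
      by (rule crossing_edge[OF conn conn' two' sep card e(1) v12(2,1)])
    then show ?thesis using that by blast
  qed
  have tw: "commutes N Q (twirl N (U e') (V e') (Y v1) + twirl N (U e') (V e') (Y v2))"
    unfolding twirl_add[symmetric] using U[OF e'(1)] V[OF e'(1)] sum by (rule commutes_twirl)
  have "commutes N Q (Y v1) \<and> commutes N Q (Y v2)"
  proof (cases "e' \<in> D v1")
    case True
    with e' have "commutes N Q (scal \<mu> (idop N) + scal \<kappa> (Y v2))"
      using tw Y1[OF e'(1) vW(1)] Y0[OF e'(1) vW(2)] by simp
    from commutes_diff[OF this id[of \<mu>]] have "commutes N Q (scal \<kappa> (Y v2))" by simp
    then have 2: "commutes N Q (Y v2)" by (rule unscal)
    from commutes_diff[OF sum this] 2 show ?thesis by simp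
  next
    case False
    with e' have "commutes N Q (scal \<kappa> (Y v1) + scal \<mu> (idop N))"
      using tw Y1[OF e'(1) vW(2)] Y0[OF e'(1) vW(1)] by simp
    from commutes_diff[OF this id[of \<mu>]] have "commutes N Q (scal \<kappa> (Y v1))" by simp
    then have 1: "commutes N Q (Y v1)" by (rule unscal)
    from commutes_diff[OF sum this] 1 show ?thesis by simp
  qed
  moreover have "v \<in> {v1, v2}" using v(1) e(2) v12(2) by blast
  ultimately show ?thesis by blast
qed

section \<open>Lattice geometry\<close>

lemma mem_dstar: "e \<in> dstar N v \<longleftrightarrow> e \<in> lattice N \<and> (tail N e = v \<or> head N e = v)"
  by (auto simp: dstar_def dplus_def dminus_def)

text \<open>Inverts the cyclic successor; y = 0 is the wrap-around.\<close>

lemma succ_mod_eq_iff: "(b::nat) < N \<Longrightarrow> y < N \<Longrightarrow> Suc b mod N = y \<longleftrightarrow> b = (if y = 0 then N - 1 else y - 1)"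
  by (auto simp: mod_Suc)

lemma tail_neq_head: "N \<ge> 2 \<Longrightarrow> e \<in> lattice N \<Longrightarrow> tail N e \<noteq> head N e"
  by (cases "(N, e)" rule: tail.cases) (auto simp: lattice_def mod_Suc)

lemma stars_of_edge:
  assumes "e \<in> lattice N"
  shows "{v \<in> vertices N. e \<in> dstar N v} = {tail N e, head N e}"
  using assms by (cases "(N, e)" rule: tail.cases) (auto simp: mem_dstar vertices_def lattice_def)

text \<open>A plaquette is named by its lower-left corner. So a horizontal edge borders the
  plaquette of its own coordinates above it and the next one below; a vertical edge borders the one
  to its right and the next one to the left.\<close>

lemma plaqs_of_edge:
  assumes "N \<ge> 2" "e \<in> lattice N"
  shows "{v \<in> vertices N. e \<in> pbound N v} = (case e of (x, y, d) \<Rightarrow>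
     {(x, y), if d then (x, if y = 0 then N - 1 else y - 1) else (if x = 0 then N - 1 else x - 1, y)})"
proof -
  obtain x y d where e: "e = (x, y, d)" by (cases e)
  have xy: "x < N" "y < N" using assms e by (auto simp: lattice_def)
  have "(a, b) \<in> vertices N \<and> e \<in> pbound N (a, b) \<longleftrightarrow> (a, b) \<in> (case e of (x, y, d) \<Rightarrow>
     {(x, y), if d then (x, if y = 0 then N - 1 else y - 1) else (if x = 0 then N - 1 else x - 1, y)})" for a b
  proof -
    have "(a, b) \<in> vertices N \<and> e \<in> pbound N (a, b) \<longleftrightarrow> a < N \<and> b < N \<and>
       (if d then a = x \<and> (Suc b mod N = y \<or> b = y) else b = y \<and> (Suc a mod N = x \<or> a = x))"
      by (auto simp: vertices_def pbound_def pplus_def pminus_def e)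
    also have "\<dots> \<longleftrightarrow> a < N \<and> b < N \<and>
       (if d then a = x \<and> (b = (if y = 0 then N - 1 else y - 1) \<or> b = y)
        else b = y \<and> (a = (if x = 0 then N - 1 else x - 1) \<or> a = x))"
      using succ_mod_eq_iff[of b N y] succ_mod_eq_iff[of a N x] xy by auto
    also have "\<dots> \<longleftrightarrow> (a, b) \<in> (case e of (x, y, d) \<Rightarrow>
     {(x, y), if d then (x, if y = 0 then N - 1 else y - 1) else (if x = 0 then N - 1 else x - 1, y)})"
      using xy by (auto simp: e)
    finally show ?thesis .
  qed
  then show ?thesis by (auto simp del: split_paired_All)
qed

lemma two_stars_of_edge:
  assumes "N \<ge> 2" "e \<in> lattice N"
  shows "\<exists>v1 v2. v1 \<noteq> v2 \<and> {v \<in> vertices N. e \<in> dstar N v} = {v1, v2}"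
  using stars_of_edge[OF assms(2)] tail_neq_head[OF assms] by blast

lemma two_plaqs_of_edge:
  assumes "N \<ge> 2" "e \<in> lattice N"
  shows "\<exists>v1 v2. v1 \<noteq> v2 \<and> {v \<in> vertices N. e \<in> pbound N v} = {v1, v2}"
proof -
  obtain x y d where e: "e = (x, y, d)" by (cases e)
  let ?q = "if d then (x, if y = 0 then N - 1 else y - 1) else (if x = 0 then N - 1 else x - 1, y)"
  have "{v \<in> vertices N. e \<in> pbound N v} = {(x, y), ?q}"
    using plaqs_of_edge[OF assms] by (simp add: e)
  moreover have "(x, y) \<noteq> ?q" using assms(1) by auto
  ultimately show ?thesis by blast
qed

text \<open>For N = 2 distinct edges can join the same two vertices, but the four sides of one
  plaquette still have different pairs of ends, because a cyclic successor differs from its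
  argument.\<close>

lemma stars_separate_plaq_edges:
  assumes N: "N \<ge> 2" and "p \<in> vertices N" "e \<in> pbound N p" "e' \<in> pbound N p"
    "e \<in> lattice N" "e' \<in> lattice N" "e \<noteq> e'"
  shows "{v \<in> vertices N. e \<in> dstar N v} \<noteq> {v \<in> vertices N. e' \<in> dstar N v}"
proof -
  obtain a b where p: "p = (a, b)" by (cases p)
  have "Suc a mod N \<noteq> a" "Suc b mod N \<noteq> b"
    using N assms(2) by (auto simp: p vertices_def mod_Suc)
  then show ?thesis
    unfolding stars_of_edge[OF assms(5)] stars_of_edge[OF assms(6)]
    using assms(3,4,7) by (auto simp: p pbound_def pplus_def pminus_def doubleton_eq_iff)
qed

text \<open>The dual fact: for N = 2 distinct edges can border the same two plaquettes, but the
  edges at one vertex do not.\<close>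

lemma plaqs_separate_star_edges:
  assumes N: "N \<ge> 2" and "s \<in> vertices N" "e \<in> dstar N s" "e' \<in> dstar N s"
    "e \<in> lattice N" "e' \<in> lattice N" "e \<noteq> e'"
  shows "{v \<in> vertices N. e \<in> pbound N v} \<noteq> {v \<in> vertices N. e' \<in> pbound N v}"
proof -
  obtain x y where s: "s = (x, y)" by (cases s)
  have xy: "x < N" "y < N" using assms(2) by (auto simp: s vertices_def)
  define x' y' where "x' = (if x = 0 then N - 1 else x - 1)" and "y' = (if y = 0 then N - 1 else y - 1)"
  have ne: "x' \<noteq> x" "y' \<noteq> y" using N by (auto simp: x'_def y'_def)
  \<comment> \<open>The four edges at s point right, up, left and down; x' and y' are the cyclic
    predecessors of x and y.\<close>
  have edges: "f \<in> {(x, y, True), (x, y, False), (x', y, True), (x, y', False)}" if "f \<in> dstar N s" for f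
  proof -
    obtain u w d where f: "f = (u, w, d)" by (cases f)
    have uw: "u < N" "w < N" using that by (auto simp: f mem_dstar lattice_def)
    show ?thesis
      using that xy uw succ_mod_eq_iff[of u N x] succ_mod_eq_iff[of w N y]
      by (cases d) (auto simp: mem_dstar f s x'_def y'_def)
  qed
  show ?thesis
    unfolding plaqs_of_edge[OF N assms(5)] plaqs_of_edge[OF N assms(6)]
    using edges[OF assms(3)] edges[OF assms(4)] assms(7) ne
    by (auto simp: x'_def[symmetric] y'_def[symmetric] doubleton_eq_iff)
qed

section \<open>Star and plaquette operators\<close>

text \<open>The translation of configurations effected by \<open>Astar_g N s g\<close>.\<close>

definition shift :: "nat \<Rightarrow> vertex \<Rightarrow> 'g::ab_group_add \<Rightarrow> edge \<Rightarrow> 'g" where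
  "shift N s g e = (if e \<in> dplus N s then g else if e \<in> dminus N s then - g else 0)"

text \<open>The holonomy of c along the counterclockwise boundary of the plaquette.\<close>

definition flux :: "nat \<Rightarrow> vertex \<Rightarrow> ('g::ab_group_add) conf \<Rightarrow> 'g" where
  "flux N p c = (case p of (a, b) \<Rightarrow> c (a, (b+1) mod N, True) + c (a, b, False)
      - c (a, b, True) - c ((a+1) mod N, b, False))"

text \<open>By orthogonality of characters this is the indicator of g = 0, so \<open>Bplaq\<close>
  projects onto flux-free configurations. Below it enters as a real function of the flux.\<close>

definition flux_weight :: "'g::{finite,ab_group_add} \<Rightarrow> complex" where
  "flux_weight g = 1 / of_nat (card (UNIV :: 'g set)) * (\<Sum>\<chi>\<in>characters. \<chi> g)"

lemma prod_indicator: "finite A \<Longrightarrow> (\<Prod>x\<in>A. if P x then 1 else (0::complex)) = (if \<forall>x\<in>A. P x then 1 else 0)"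
  by (induction A rule: finite_induct) auto

lemma finite_dstar: "finite (dstar N s)"
  using finite_lattice by (rule finite_subset[rotated]) (auto simp: mem_dstar)

lemma shift_off: "e \<notin> dstar N s \<Longrightarrow> shift N s g e = 0"
  by (auto simp: shift_def dstar_def)

section \<open>Star operators as translations of configurations\<close>

lemma Astar_g_apply:
  "Astar_g N s g c c' = (if c \<in> confs N \<and> c' \<in> confs N \<and> (\<forall>e. c e = shift N s g e + c' e) then 1 else 0)"
proof (cases "c \<in> confs N \<and> c' \<in> confs N")
  case True
  have "(\<Prod>e\<in>dstar N s. (if e \<in> dplus N s then Lop g else Lop (- g)) (c e) (c' e)) =
     (\<Prod>e\<in>dstar N s. if c e = shift N s g e + c' e then 1 else 0)"
    by (rule prod.cong) (auto simp: Lop_def shift_def dstar_def)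
  also have "\<dots> = (if \<forall>e\<in>dstar N s. c e = shift N s g e + c' e then 1 else 0)"
    by (rule prod_indicator[OF finite_dstar])
  finally have prod: "(\<Prod>e\<in>dstar N s. (if e \<in> dplus N s then Lop g else Lop (- g)) (c e) (c' e)) =
     (if \<forall>e\<in>dstar N s. c e = shift N s g e + c' e then 1 else 0)" .
  have "Astar_g N s g c c' = (if (\<forall>e. e \<notin> dstar N s \<longrightarrow> c e = c' e) \<and>
     (\<forall>e\<in>dstar N s. c e = shift N s g e + c' e) then 1 else 0)"
    unfolding Astar_g_def tensor_def prod using True confs_eq_off[of c N c' "dstar N s"] by auto
  moreover have "(\<forall>e. e \<notin> dstar N s \<longrightarrow> c e = c' e) \<and> (\<forall>e\<in>dstar N s. c e = shift N s g e + c' e)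
     \<longleftrightarrow> (\<forall>e. c e = shift N s g e + c' e)"
    by (metis add_0 shift_off)
  ultimately show ?thesis using True by simp
qed (auto simp: Astar_g_def tensor_def)

lemma Astar_apply: "Astar N s c c' = 1 / of_nat (card (UNIV :: 'g set)) * (\<Sum>g\<in>UNIV. Astar_g N s g c c')"
  for c :: "('g::{finite,ab_group_add}) conf"
  by (simp add: Astar_def scal_def sum_gop_apply)

lemma Astar_ops: "Astar N s \<in> ops N" for N :: nat
  by (auto simp: ops_def Astar_apply Astar_g_apply)

lemma shift_uminus: "shift N s (- g) e = - shift N s g e"
  by (simp add: shift_def)

lemma adj_Astar_g: "adj (Astar_g N s g) = Astar_g N s (- g)"
proof (intro ext)
  fix c c' :: "'a conf"
  have "(\<forall>e. c' e = shift N s g e + c e) \<longleftrightarrow> (\<forall>e. c e = shift N s (- g) e + c' e)"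
    by (auto simp: shift_uminus)
  then show "adj (Astar_g N s g) c c' = Astar_g N s (- g) c c'"
    by (auto simp: adj_def Astar_g_apply)
qed

lemma adj_Astar: "adj (Astar N s :: ('g::{finite,ab_group_add}) gop) = Astar N s"
proof -
  have "(\<Sum>g\<in>UNIV. Astar_g N s (- g)) = (\<Sum>g\<in>UNIV. Astar_g N s (g :: 'g))"
    by (rule sum.reindex_bij_witness[of _ uminus uminus]) auto
  then show ?thesis
    by (simp add: Astar_def adj_scal adj_sum adj_Astar_g)
qed

lemma mm_Astar_g_left:
  fixes Z :: "('g::{finite,ab_group_add}) gop"
  assumes "c \<in> confs N"
  shows "mm N (Astar_g N s g) Z c c' = Z (\<lambda>e. c e - shift N s g e) c'"
proof -
  let ?d = "\<lambda>e. c e - shift N s g e"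
  have eq: "(\<forall>e. c e = shift N s g e + d e) \<longleftrightarrow> d = ?d" for d
    by (auto simp: fun_eq_iff algebra_simps)
  have d: "?d \<in> confs N"
    using assms by (auto simp: confs_def shift_off mem_dstar)
  have "mm N (Astar_g N s g) Z c c' = (\<Sum>d\<in>confs N. if d = ?d then Z d c' else 0)"
    unfolding mm_def Astar_g_apply eq using assms by (intro sum.cong refl) auto
  then show ?thesis using d by (simp add: finite_confs)
qed

lemma commutes_Astar_g: "commutes N (Astar_g N s g) (Astar_g N s' (g' :: 'g::{finite,ab_group_add}))"
  unfolding commutes_def
proof (intro ext)
  fix c c' :: "'g conf"
  have out: "mm N (Astar_g N s g) (Astar_g N s' g') c c' = 0" if "c \<notin> confs N" for s s' g g'
    using that by (simp add: mm_def Astar_g_apply)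
  have "(\<forall>e. c e - shift N s g e = shift N s' g' e + c' e) \<longleftrightarrow> (\<forall>e. c e - shift N s' g' e = shift N s g e + c' e)"
    by (simp add: algebra_simps)
  moreover have "(\<lambda>e. c e - shift N s g e) \<in> confs N" if "c \<in> confs N" for s g
    using that by (auto simp: confs_def shift_off mem_dstar)
  ultimately show "mm N (Astar_g N s g) (Astar_g N s' g') c c' = mm N (Astar_g N s' g') (Astar_g N s g) c c'"
    by (cases "c \<in> confs N") (simp_all add: mm_Astar_g_left out, simp_all add: Astar_g_apply)
qed

lemma commutes_Astar: "commutes N (Astar N s) (Astar N s' :: ('g::{finite,ab_group_add}) gop)"
proof -
  have *: "commutes N (Astar_g N s g) (Astar N s' :: 'g gop)" for g
    unfolding Astar_def by (intro commutes_scal commutes_sum commutes_Astar_g)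
  have "commutes N (Astar N s') (Astar N s :: 'g gop)"
    unfolding Astar_def[of N s] by (intro commutes_scal commutes_sum commutes_sym[OF *])
  then show ?thesis by (rule commutes_sym)
qed

section \<open>Characters and the diagonal form of plaquette operators\<close>

lemma character_zero: "is_character \<chi> \<Longrightarrow> \<chi> 0 = 1"
proof -
  assume "is_character \<chi>"
  then have "\<chi> (0 + 0) = \<chi> 0 * \<chi> 0" "norm (\<chi> 0) = 1" by (simp_all only: is_character_def)
  then show ?thesis by (metis add_0 mult_cancel_left1 norm_zero zero_neq_one)
qed

lemma character_uminus:
  assumes "is_character \<chi>"
  shows "\<chi> (- g) = cnj (\<chi> g)"
proof -
  have "\<chi> g * \<chi> (- g) = 1"
    using assms character_zero[OF assms] unfolding is_character_def by (metis add.right_inverse)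
  moreover have "\<chi> g * cnj (\<chi> g) = 1"
    using assms by (simp add: is_character_def complex_norm_square[symmetric])
  ultimately show ?thesis
    by (metis mult_cancel_left mult_zero_left zero_neq_one)
qed

lemma character_diff: "is_character \<chi> \<Longrightarrow> \<chi> (g - h) = \<chi> g * cnj (\<chi> h)"
  by (metis character_uminus diff_conv_add_uminus is_character_def)


lemma finite_pbound: "finite (pbound N p)"
  by (simp add: pbound_def pplus_def pminus_def split: prod.split)

text \<open>For N \<ge> 2 the four boundary edges are distinct, so each contributes its own factor;
  the conjugates on clockwise edges become the minus signs of the flux.\<close>

lemma prod_pbound:
  fixes \<chi> :: "'g::{finite,ab_group_add} \<Rightarrow> complex"
  assumes N: "N \<ge> 2" and p: "p \<in> vertices N" and \<chi>: "is_character \<chi>"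
  shows "(\<Prod>e\<in>pbound N p. if e \<in> pplus N p then \<chi> (c e) else cnj (\<chi> (c e))) = \<chi> (flux N p c)"
proof -
  obtain a b where ab: "p = (a, b)" by (cases p)
  have ne: "Suc a mod N \<noteq> a" "Suc b mod N \<noteq> b"
    using N p by (auto simp: ab vertices_def mod_Suc)
  have "pbound N p = {(a, Suc b mod N, True), (a, b, False), (a, b, True), (Suc a mod N, b, False)}"
    by (auto simp: ab pbound_def pplus_def pminus_def)
  moreover have "pplus N p = {(a, Suc b mod N, True), (a, b, False)}"
    by (simp add: ab pplus_def)
  moreover have "\<chi> (g + h) = \<chi> g * \<chi> h" for g h using \<chi> by (simp add: is_character_def)
  ultimately show ?thesis
    using ne by (simp add: flux_def ab character_diff[OF \<chi>] ne[symmetric] mult.assoc)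
qed

lemma Bplaq_chi_apply:
  fixes \<chi> :: "'g::{finite,ab_group_add} \<Rightarrow> complex"
  assumes N: "N \<ge> 2" and p: "p \<in> vertices N" and \<chi>: "is_character \<chi>"
  shows "Bplaq_chi N p \<chi> c c' = (if c \<in> confs N \<and> c = c' then \<chi> (flux N p c) else 0)"
proof (cases "c \<in> confs N \<and> c' \<in> confs N \<and> (\<forall>e\<in>lattice N - pbound N p. c e = c' e)")
  case True
  then have off: "\<forall>e. e \<notin> pbound N p \<longrightarrow> c e = c' e"
    using confs_eq_off[of c N c' "pbound N p"] by blast
  have *: "Bplaq_chi N p \<chi> c c' =
     (\<Prod>e\<in>pbound N p. (if e \<in> pplus N p then Mop \<chi> else Mop (\<lambda>g. cnj (\<chi> g))) (c e) (c' e))"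
    using True by (simp add: Bplaq_chi_def tensor_def)
  show ?thesis
  proof (cases "c = c'")
    case True
    have "(\<Prod>e\<in>pbound N p. (if e \<in> pplus N p then Mop \<chi> else Mop (\<lambda>g. cnj (\<chi> g))) (c e) (c' e)) =
      (\<Prod>e\<in>pbound N p. if e \<in> pplus N p then \<chi> (c e) else cnj (\<chi> (c e)))"
      using True by (intro prod.cong refl) (auto simp: Mop_def)
    then have "Bplaq_chi N p \<chi> c c' = \<chi> (flux N p c)"
      unfolding * prod_pbound[OF assms] .
    then show ?thesis
      using True \<open>c \<in> confs N \<and> _\<close> by simp
  next
    case False
    then obtain e where e: "c e \<noteq> c' e" by blast
    with off have "e \<in> pbound N p" by blast
    then have "(\<Prod>e\<in>pbound N p. (if e \<in> pplus N p then Mop \<chi> else Mop (\<lambda>g. cnj (\<chi> g))) (c e) (c' e)) = 0"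
      using e by (intro prod_zero finite_pbound) (auto simp: Mop_def)
    then show ?thesis using False by (simp add: *)
  qed
qed (auto simp: Bplaq_chi_def tensor_def)

lemma Bplaq_apply:
  fixes c :: "('g::{finite,ab_group_add}) conf"
  assumes "N \<ge> 2" "p \<in> vertices N"
  shows "Bplaq N p c c' = (if c \<in> confs N \<and> c = c' then flux_weight (flux N p c) else 0)"
proof -
  have "(\<Sum>\<chi>\<in>characters. Bplaq_chi N p \<chi> c c') =
    (\<Sum>\<chi>\<in>characters. if c \<in> confs N \<and> c = c' then \<chi> (flux N p c) else 0)"
    by (rule sum.cong) (simp_all add: characters_def Bplaq_chi_apply[OF assms])
  also have "\<dots> = (if c \<in> confs N \<and> c = c' then \<Sum>\<chi>\<in>characters. \<chi> (flux N p c) else 0)"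
    by auto
  finally show ?thesis
    unfolding Bplaq_def scal_def sum_gop_apply flux_weight_def by auto
qed

lemma cnj_flux_weight: "cnj (flux_weight g) = flux_weight g"
proof -
  have "(\<Sum>\<chi>\<in>characters. cnj (\<chi> g)) = (\<Sum>\<chi>\<in>characters. \<chi> g)"
    by (rule sum.reindex_bij_witness[of _ "\<lambda>\<chi> g. cnj (\<chi> g)" "\<lambda>\<chi> g. cnj (\<chi> g)"])
       (auto simp: characters_def is_character_def)
  then show ?thesis by (simp add: flux_weight_def)
qed

lemma Bplaq_ops: "N \<ge> 2 \<Longrightarrow> p \<in> vertices N \<Longrightarrow> Bplaq N p \<in> ops N"
  by (auto simp: ops_def Bplaq_apply)

lemma adj_Bplaq: "N \<ge> 2 \<Longrightarrow> p \<in> vertices N \<Longrightarrow> adj (Bplaq N p) = Bplaq N p"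
  by (intro ext) (auto simp: adj_def Bplaq_apply cnj_flux_weight)

lemma mm_Bplaq_left:
  fixes Z :: "('g::{finite,ab_group_add}) gop"
  assumes "N \<ge> 2" "p \<in> vertices N" "c \<in> confs N"
  shows "mm N (Bplaq N p) Z c c' = flux_weight (flux N p c) * Z c c'"
proof -
  have "mm N (Bplaq N p) Z c c' = (\<Sum>d\<in>confs N. if c = d then flux_weight (flux N p c) * Z d c' else 0)"
    unfolding mm_def using assms by (intro sum.cong refl) (simp add: Bplaq_apply)
  then show ?thesis using assms by (simp add: finite_confs)
qed

lemma mm_Bplaq_right:
  fixes Z :: "('g::{finite,ab_group_add}) gop"
  assumes "N \<ge> 2" "p \<in> vertices N" "c' \<in> confs N"
  shows "mm N Z (Bplaq N p) c c' = Z c c' * flux_weight (flux N p c')"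
proof -
  have "mm N Z (Bplaq N p) c c' = (\<Sum>d\<in>confs N. if d = c' then Z c d * flux_weight (flux N p c') else 0)"
    unfolding mm_def using assms by (intro sum.cong refl) (simp add: Bplaq_apply)
  then show ?thesis using assms by (simp add: finite_confs)
qed

text \<open>\<open>Bplaq\<close> is diagonal with entries depending only on the flux, hence constant
  along every nonzero entry of Z.\<close>

lemma commutes_Bplaq_if_flux_preserving:
  fixes Z :: "('g::{finite,ab_group_add}) gop"
  assumes N: "N \<ge> 2" "p \<in> vertices N" and Z: "Z \<in> ops N"
    and fl: "\<And>c c'. c \<in> confs N \<Longrightarrow> c' \<in> confs N \<Longrightarrow> Z c c' \<noteq> 0 \<Longrightarrow> flux N p c = flux N p c'"
  shows "commutes N Z (Bplaq N p)"
  unfolding commutes_def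
proof (intro ext)
  fix c c' :: "'g conf"
  show "mm N Z (Bplaq N p) c c' = mm N (Bplaq N p) Z c c'"
  proof (cases "c \<in> confs N \<and> c' \<in> confs N")
    case True
    then show ?thesis
      using fl[of c c'] by (cases "Z c c' = 0") (auto simp: mm_Bplaq_left[OF N] mm_Bplaq_right[OF N])
  next
    case False
    then show ?thesis
      using ops_mm[OF Z Bplaq_ops[OF N]] ops_mm[OF Bplaq_ops[OF N] Z] by (auto simp: ops_def)
  qed
qed

text \<open>The shift is the coboundary of the function that is g at s and 0 elsewhere. Tail and
  head differ for N \<ge> 2, so the two nonzero cases of \<open>shift\<close> exclude each
  other.\<close>

lemma shift_eq_coboundary:
  assumes "N \<ge> 2" "e \<in> lattice N"
  shows "shift N s g e = (if tail N e = s then g else 0) - (if head N e = s then g else 0)"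
  using tail_neq_head[OF assms] assms by (auto simp: shift_def dplus_def dminus_def)

text \<open>A coboundary has no holonomy around a closed loop: every corner of the plaquette enters
  twice with opposite signs. This covers all positions of s relative to p at once, including the
  wrap-around.\<close>

lemma flux_shift:
  fixes c :: "('g::{finite,ab_group_add}) conf"
  assumes N: "N \<ge> 2" and p: "p \<in> vertices N" and c: "\<forall>e. c e = shift N s g e + c' e"
  shows "flux N p c = flux N p c'"
proof -
  obtain a b where ab: "p = (a, b)" by (cases p)
  have l: "a < N" "b < N" using p by (auto simp: ab vertices_def)
  define f where "f v = (if v = s then g else 0)" for v
  have sh: "shift N s g e = f (tail N e) - f (head N e)" if "e \<in> lattice N" for e
    unfolding f_def by (rule shift_eq_coboundary[OF N that])
  have "shift N s g (a, Suc b mod N, True) = f (Suc a mod N, Suc b mod N) - f (a, Suc b mod N)"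
    "shift N s g (a, b, False) = f (a, Suc b mod N) - f (a, b)"
    "shift N s g (a, b, True) = f (Suc a mod N, b) - f (a, b)"
    "shift N s g (Suc a mod N, b, False) = f (Suc a mod N, Suc b mod N) - f (Suc a mod N, b)"
    using l by (simp_all add: sh lattice_def)
  then show ?thesis
    by (simp add: flux_def ab c)
qed

lemma commutes_Astar_Bplaq:
  assumes N: "N \<ge> 2" "p \<in> vertices N"
  shows "commutes N (Astar N s) (Bplaq N p :: ('g::{finite,ab_group_add}) gop)"
proof (rule commutes_Bplaq_if_flux_preserving[OF N Astar_ops])
  fix c c' :: "'g conf" assume "c \<in> confs N" "c' \<in> confs N" "Astar N s c c' \<noteq> 0"
  then obtain g where "Astar_g N s g c c' \<noteq> 0"
    unfolding Astar_apply by (metis mult_zero_right sum.neutral)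
  then have "\<forall>e. c e = shift N s g e + c' e"
    unfolding Astar_g_apply by meson
  then show "flux N p c = flux N p c'" by (rule flux_shift[OF N])
qed

lemma commutes_Bplaq:
  assumes "N \<ge> 2" "p \<in> vertices N" "q \<in> vertices N"
  shows "commutes N (Bplaq N q) (Bplaq N p :: ('g::{finite,ab_group_add}) gop)"
  using assms by (intro commutes_Bplaq_if_flux_preserving Bplaq_ops) (auto simp: Bplaq_apply split: if_splits)

section \<open>Locality of the cell terms\<close>

lemma blind_Astar:
  assumes e: "e \<in> lattice N" "e \<notin> dstar N s"
  shows "blind N e (Astar N s :: ('g::{finite,ab_group_add}) gop)"
  unfolding blind_def
proof (intro ballI)
  fix c c' :: "'g conf" assume c: "c \<in> confs N" "c' \<in> confs N"
  have "Astar_g N s g (c(e := a)) (c'(e := b)) =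
     (if a = b then (if \<forall>e'. e' \<noteq> e \<longrightarrow> c e' = shift N s g e' + c' e' then 1 else 0) else 0)" for a b g
    using c e shift_off[OF e(2), of g] by (auto simp: Astar_g_apply confs_upd)
  then have "Astar N s (c(e := a)) (c'(e := b)) = (if a = b then
     1 / of_nat (card (UNIV :: 'g set)) * (\<Sum>g\<in>UNIV. if \<forall>e'. e' \<noteq> e \<longrightarrow> c e' = shift N s g e' + c' e' then 1 else 0) else 0)" for a b
    by (simp add: Astar_apply)
  then show "\<exists>k. \<forall>a b. Astar N s (c(e := a)) (c'(e := b)) = (if a = b then k else 0)"
    by blast
qed

lemma flux_upd_off: "e \<notin> pbound N p \<Longrightarrow> flux N p (c(e := a)) = flux N p c"
  by (auto simp: flux_def pbound_def pplus_def pminus_def split: prod.splits)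

lemma blind_Bplaq:
  assumes N: "N \<ge> 2" "p \<in> vertices N" and e: "e \<in> lattice N" "e \<notin> pbound N p"
  shows "blind N e (Bplaq N p :: ('g::{finite,ab_group_add}) gop)"
  unfolding blind_def
proof (intro ballI)
  fix c c' :: "'g conf" assume c: "c \<in> confs N" "c' \<in> confs N"
  have "c(e := a) = c'(e := b) \<longleftrightarrow> a = b \<and> (\<forall>e'. e' \<noteq> e \<longrightarrow> c e' = c' e')" for a b
    by (auto simp: fun_eq_iff)
  then have "Bplaq N p (c(e := a)) (c'(e := b)) = (if a = b then
     (if \<forall>e'. e' \<noteq> e \<longrightarrow> c e' = c' e' then flux_weight (flux N p c) else 0) else 0)" for a b
    using c e(1) by (auto simp: Bplaq_apply[OF N] confs_upd flux_upd_off[OF e(2)])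
  then show "\<exists>k. \<forall>a b. Bplaq N p (c(e := a)) (c'(e := b)) = (if a = b then k else 0)"
    by blast
qed

section \<open>Dephasing and shift twirls of the cell terms\<close>

text \<open>The projection |g><g| at e; twirling with these keeps exactly the entries diagonal at
  e.\<close>

definition edge_unit :: "nat \<Rightarrow> edge \<Rightarrow> 'g \<Rightarrow> ('g::zero) gop" where
  "edge_unit N e g = at_edge N e (\<lambda>a b. if a = g \<and> b = g then 1 else 0)"

definition edge_shift :: "nat \<Rightarrow> edge \<Rightarrow> 'g \<Rightarrow> ('g::ab_group_add) gop" where
  "edge_shift N e g = at_edge N e (Lop g)"

abbreviation dephase :: "nat \<Rightarrow> edge \<Rightarrow> ('g::{finite,ab_group_add}) gop \<Rightarrow> 'g gop" where
  "dephase N e \<equiv> twirl N (edge_unit N e) (edge_unit N e)"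

abbreviation shift_twirl :: "nat \<Rightarrow> edge \<Rightarrow> ('g::{finite,ab_group_add}) gop \<Rightarrow> 'g gop" where
  "shift_twirl N e \<equiv> twirl N (edge_shift N e) (\<lambda>g. edge_shift N e (- g))"

lemma gop_eqI:
  assumes "A \<in> ops N" "B \<in> ops N" "\<And>c c'. c \<in> confs N \<Longrightarrow> c' \<in> confs N \<Longrightarrow> A c c' = B c c'"
  shows "A = B"
proof (intro ext)
  fix c c'
  show "A c c' = B c c'"
    using assms by (cases "c \<in> confs N \<and> c' \<in> confs N") (auto simp: ops_def)
qed

lemma twirl_ops: "(\<And>j. U j \<in> ops N) \<Longrightarrow> (\<And>j. V j \<in> ops N) \<Longrightarrow> Y \<in> ops N \<Longrightarrow> twirl N U V Y \<in> ops N"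
  unfolding twirl_def by (intro ops_sum ops_mm)

lemma dephase_ops: "Y \<in> ops N \<Longrightarrow> dephase N e Y \<in> ops N"
  by (intro twirl_ops) (simp_all add: edge_unit_def at_edge_ops)

lemma shift_twirl_ops: "Y \<in> ops N \<Longrightarrow> shift_twirl N e Y \<in> ops N"
  by (intro twirl_ops) (simp_all add: edge_shift_def at_edge_ops)

lemma dephase_apply:
  fixes c :: "('g::{finite,ab_group_add}) conf"
  assumes "e \<in> lattice N" "c \<in> confs N" "c' \<in> confs N"
  shows "dephase N e Y c c' = (if c e = c' e then Y c c' else 0)"
proof -
  have "mm N (edge_unit N e g) (mm N Y (edge_unit N e g)) c c' = (if c e = g \<and> c' e = g then Y c c' else 0)" for g
  proof -
    have "mm N (edge_unit N e g) (mm N Y (edge_unit N e g)) c c' =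
      (\<Sum>a\<in>UNIV. (if c e = g \<and> a = g then 1 else 0) * (\<Sum>b\<in>UNIV. Y (c(e := a)) (c'(e := b)) * (if b = g \<and> c' e = g then 1 else 0)))"
      unfolding edge_unit_def using assms by (simp add: mm_at_edge_left mm_at_edge_right)
    also have "\<dots> = (\<Sum>a\<in>UNIV. if a = g then (if c e = g \<and> c' e = g then Y (c(e := g)) (c'(e := g)) else 0) else 0)"
      by (rule sum.cong[OF refl]) (auto simp: if_distrib[of "\<lambda>x. _ * x"] cong: if_cong)
    also have "\<dots> = (if c e = g \<and> c' e = g then Y c c' else 0)"
      by (auto simp: fun_upd_idem)
    finally show ?thesis .
  qed
  then have "dephase N e Y c c' = (\<Sum>g\<in>UNIV. if c e = g \<and> c' e = g then Y c c' else 0)"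
    unfolding twirl_def sum_gop_apply by simp
  also have "\<dots> = (\<Sum>g\<in>UNIV. if g = c e then (if c e = c' e then Y c c' else 0) else 0)"
    by (rule sum.cong) auto
  finally show ?thesis by simp
qed

lemma shift_twirl_apply:
  fixes c :: "('g::{finite,ab_group_add}) conf"
  assumes "e \<in> lattice N" "c \<in> confs N" "c' \<in> confs N"
  shows "shift_twirl N e Y c c' = (\<Sum>g\<in>UNIV. Y (c(e := c e - g)) (c'(e := c' e - g)))"
  unfolding twirl_def sum_gop_apply
proof (rule sum.cong[OF refl])
  fix g :: 'g
  have "mm N (edge_shift N e g) (mm N Y (edge_shift N e (- g))) c c' =
      (\<Sum>a\<in>UNIV. (if c e = g + a then 1 else 0) * (\<Sum>b\<in>UNIV. Y (c(e := a)) (c'(e := b)) * (if b = - g + c' e then 1 else 0)))"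
    unfolding edge_shift_def using assms by (simp add: mm_at_edge_left mm_at_edge_right Lop_def)
  also have "\<dots> = (\<Sum>a\<in>UNIV. if a = c e - g then Y (c(e := c e - g)) (c'(e := - g + c' e)) else 0)"
    by (rule sum.cong[OF refl]) (auto simp: if_distrib[of "\<lambda>x. _ * x"] cong: if_cong)
  finally show "mm N (edge_shift N e g) (mm N Y (edge_shift N e (- g))) c c' = Y (c(e := c e - g)) (c'(e := c' e - g))"
    by simp
qed

lemma dephase_idop: "e \<in> lattice N \<Longrightarrow> dephase N e (idop N) = idop N"
  by (intro gop_eqI[of _ N] dephase_ops idop_ops) (auto simp: dephase_apply idop_def)

lemma confs_upd_self_diff: "c(e := c e - g) = c'(e := c' e - g) \<longleftrightarrow> c = c'" for g :: "'g::ab_group_add"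
proof
  assume eq: "c(e := c e - g) = c'(e := c' e - g)"
  show "c = c'"
  proof
    fix x
    show "c x = c' x" using fun_cong[OF eq, of x] by (cases "x = e") auto
  qed
qed simp

lemma shift_twirl_idop:
  "e \<in> lattice N \<Longrightarrow>
   shift_twirl N e (idop N :: ('g::{finite,ab_group_add}) gop) = scal (of_nat (card (UNIV :: 'g set))) (idop N)"
  by (intro gop_eqI[of _ N] shift_twirl_ops ops_scal idop_ops)
     (auto simp: shift_twirl_apply idop_def confs_upd_self_diff confs_upd scal_def)

lemma dephase_Bplaq:
  assumes "N \<ge> 2" "p \<in> vertices N" "e \<in> lattice N"
  shows "dephase N e (Bplaq N p) = Bplaq N p"
  using assms by (intro gop_eqI[of _ N] dephase_ops Bplaq_ops) (auto simp: dephase_apply Bplaq_apply)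

lemma dephase_Astar_off:
  assumes e: "e \<in> lattice N" "e \<notin> dstar N s"
  shows "dephase N e (Astar N s) = Astar N s"
proof (intro gop_eqI[of _ N] dephase_ops Astar_ops)
  fix c c' :: "'a conf" assume c: "c \<in> confs N" "c' \<in> confs N"
  have "Astar_g N s g c c' = 0" if "c e \<noteq> c' e" for g
    using that shift_off[OF e(2), of g] by (auto simp: Astar_g_apply intro!: exI[of _ e])
  then show "dephase N e (Astar N s) c c' = Astar N s c c'"
    using e c by (auto simp: dephase_apply Astar_apply)
qed

text \<open>Every g other than 0 changes the value at e, so only the identity summand of the group
  average survives, with its weight 1/|G|.\<close>

lemma dephase_Astar_on:
  assumes e: "e \<in> lattice N" "e \<in> dstar N s"
  shows "dephase N e (Astar N s :: ('g::{finite,ab_group_add}) gop) = scal (1 / of_nat (card (UNIV :: 'g set))) (idop N)"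
proof (intro gop_eqI[of _ N] dephase_ops Astar_ops ops_scal idop_ops)
  fix c c' :: "'g conf" assume c: "c \<in> confs N" "c' \<in> confs N"
  have s0: "shift N s 0 e' = (0 :: 'g)" for e' by (simp add: shift_def)
  have "Astar_g N s g c c' = (if g = 0 then (if c = c' then 1 else 0) else 0)" if "c e = c' e" for g
  proof -
    have "g = 0" if "\<forall>e. c e = shift N s g e + c' e"
    proof -
      have "shift N s g e = 0" using that \<open>c e = c' e\<close> by (metis add_cancel_left_left)
      then show ?thesis using e(2) by (auto simp: shift_def dstar_def split: if_splits)
    qed
    then show ?thesis using c by (auto simp: Astar_g_apply s0 fun_eq_iff)
  qed
  then show "dephase N e (Astar N s) c c' = scal (1 / of_nat (card (UNIV :: 'g set))) (idop N) c c'"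
    using e c by (auto simp: dephase_apply Astar_apply idop_def scal_def)
qed

text \<open>Translating both configurations at e by the same amount respects the relation that one
  is a shift of the other, so all summands give the same entry, whether or not e lies in the
  star.\<close>

lemma shift_twirl_Astar:
  assumes e: "e \<in> lattice N"
  shows "shift_twirl N e (Astar N s :: ('g::{finite,ab_group_add}) gop) = scal (of_nat (card (UNIV :: 'g set))) (Astar N s)"
proof (intro gop_eqI[of _ N] shift_twirl_ops Astar_ops ops_scal)
  fix c c' :: "'g conf" assume c: "c \<in> confs N" "c' \<in> confs N"
  have "(\<forall>e'. (c(e := c e - g)) e' = shift N s g' e' + (c'(e := c' e - g)) e') \<longleftrightarrow> (\<forall>e'. c e' = shift N s g' e' + c' e')" for g g'
  proof (rule all_cong1)
    fix e'
    show "(c(e := c e - g)) e' = shift N s g' e' + (c'(e := c' e - g)) e' \<longleftrightarrow> c e' = shift N s g' e' + c' e'"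
      by (cases "e' = e") (auto simp: algebra_simps)
  qed
  then have "Astar_g N s g' (c(e := c e - g)) (c'(e := c' e - g)) = Astar_g N s g' c c'" for g g'
    unfolding Astar_g_apply by (simp only: confs_upd[OF e])
  then have "Astar N s (c(e := c e - g)) (c'(e := c' e - g)) = Astar N s c c'" for g
    by (simp only: Astar_apply)
  then show "shift_twirl N e (Astar N s) c c' = scal (of_nat (card (UNIV :: 'g set))) (Astar N s) c c'"
    using e c by (simp add: shift_twirl_apply scal_def)
qed

lemma shift_twirl_Bplaq_off:
  assumes N: "N \<ge> 2" "p \<in> vertices N" and e: "e \<in> lattice N" "e \<notin> pbound N p"
  shows "shift_twirl N e (Bplaq N p :: ('g::{finite,ab_group_add}) gop) = scal (of_nat (card (UNIV :: 'g set))) (Bplaq N p)"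
  by (intro gop_eqI[of _ N] shift_twirl_ops Bplaq_ops N ops_scal)
     (auto simp: shift_twirl_apply e Bplaq_apply[OF N] confs_upd_self_diff confs_upd flux_upd_off scal_def)

lemma flux_upd_on:
  fixes c :: "('g::ab_group_add) conf"
  assumes N: "N \<ge> 2" and p: "p \<in> vertices N" and e: "e \<in> pbound N p"
  shows "flux N p (c(e := c e - g)) = (if e \<in> pplus N p then flux N p c - g else flux N p c + g)"
proof -
  obtain a b where ab: "p = (a, b)" by (cases p)
  have ne: "Suc a mod N \<noteq> a" "Suc b mod N \<noteq> b"
    using N p by (auto simp: ab vertices_def mod_Suc)
  show ?thesis
    using e ne ne[symmetric] by (auto simp: ab flux_def pbound_def pplus_def pminus_def)
qed

text \<open>As g runs through G, so does the flux, for either orientation of e; every diagonal entry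
  becomes the sum of all flux weights.\<close>

lemma shift_twirl_Bplaq_on:
  assumes N: "N \<ge> 2" "p \<in> vertices N" and e: "e \<in> lattice N" "e \<in> pbound N p"
  shows "shift_twirl N e (Bplaq N p :: ('g::{finite,ab_group_add}) gop) = scal (\<Sum>g\<in>UNIV. flux_weight (g :: 'g)) (idop N)"
proof (intro gop_eqI[of _ N] shift_twirl_ops Bplaq_ops N ops_scal idop_ops)
  fix c c' :: "'g conf" assume c: "c \<in> confs N" "c' \<in> confs N"
  have minus: "(\<Sum>g\<in>UNIV. flux_weight (f - g)) = (\<Sum>g\<in>UNIV. flux_weight (g :: 'g))" for f :: 'g
    by (rule sum.reindex_bij_witness[of _ "\<lambda>g. f - g" "\<lambda>g. f - g"]) auto
  have plus: "(\<Sum>g\<in>UNIV. flux_weight (f + g)) = (\<Sum>g\<in>UNIV. flux_weight (g :: 'g))" for f :: 'g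
    by (rule sum.reindex_bij_witness[of _ "\<lambda>g. g - f" "\<lambda>g. f + g"]) auto
  have "(\<Sum>g\<in>UNIV. flux_weight (flux N p (c(e := c e - g)))) = (\<Sum>g\<in>UNIV. flux_weight (g :: 'g))"
    by (cases "e \<in> pplus N p") (simp_all add: flux_upd_on[OF N e(2)] minus plus)
  then show "shift_twirl N e (Bplaq N p) c c' = scal (\<Sum>g\<in>UNIV. flux_weight (g :: 'g)) (idop N) c c'"
    using c e(1) by (auto simp: shift_twirl_apply Bplaq_apply[OF N] confs_upd_self_diff confs_upd scal_def idop_def)
qed

section \<open>The Hamiltonian\<close>

lemma finite_vertices: "finite (vertices N)"
proof -
  have "vertices N \<subseteq> {..<N} \<times> {..<N}" by (auto simp: vertices_def)
  then show ?thesis by (rule finite_subset) simp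
qed

lemma stars_of_lattice: "stars_of N (lattice N) = vertices N"
proof -
  have "(x, y, True) \<in> dstar N (x, y) \<inter> lattice N" if "(x, y) \<in> vertices N" for x y
    using that by (simp add: mem_dstar lattice_def vertices_def)
  then show ?thesis by (auto simp: stars_of_def)
qed

lemma plaqs_of_lattice: "plaqs_of N (lattice N) = vertices N"
proof -
  have "(x, y, True) \<in> pbound N (x, y) \<inter> lattice N" if "(x, y) \<in> vertices N" for x y
    using that by (simp add: pbound_def pminus_def lattice_def vertices_def)
  then show ?thesis by (auto simp: plaqs_of_def)
qed

lemma stars_of_subset: "stars_of N V \<subseteq> vertices N" and plaqs_of_subset: "plaqs_of N V \<subseteq> vertices N"
  by (auto simp: stars_of_def plaqs_of_def)

lemma Ham_ops: "N \<ge> 2 \<Longrightarrow> Ham N V \<in> ops N"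
  unfolding Ham_def using plaqs_of_subset
  by (intro ops_diff ops_uminus ops_sum Astar_ops Bplaq_ops) auto

lemma adj_Ham:
  assumes "N \<ge> 2"
  shows "adj (Ham N V) = Ham N V"
proof -
  have "(\<Sum>p\<in>plaqs_of N V. adj (Bplaq N p)) = (\<Sum>p\<in>plaqs_of N V. Bplaq N p)"
    using plaqs_of_subset[of N V] assms by (intro sum.cong refl adj_Bplaq) auto
  then show ?thesis
    by (simp add: Ham_def adj_diff adj_uminus adj_sum adj_Astar)
qed

lemma Ham_lattice_diff:
  "Ham N (lattice N) - (Ham N V :: ('g::{finite,ab_group_add}) gop) =
   - (\<Sum>s\<in>vertices N - stars_of N V. Astar N s) - (\<Sum>p\<in>vertices N - plaqs_of N V. Bplaq N p)"
proof -
  have "(\<Sum>s\<in>vertices N. Astar N s :: 'g gop) = (\<Sum>s\<in>vertices N - stars_of N V. Astar N s) + (\<Sum>s\<in>stars_of N V. Astar N s)"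
    by (rule sum.subset_diff[OF stars_of_subset finite_vertices])
  moreover have "(\<Sum>p\<in>vertices N. Bplaq N p :: 'g gop) = (\<Sum>p\<in>vertices N - plaqs_of N V. Bplaq N p) + (\<Sum>p\<in>plaqs_of N V. Bplaq N p)"
    by (rule sum.subset_diff[OF plaqs_of_subset finite_vertices])
  ultimately show ?thesis
    by (simp add: Ham_def stars_of_lattice plaqs_of_lattice)
qed

lemma commutes_Ham:
  assumes "N \<ge> 2"
  shows "commutes N (Ham N V) (Ham N V' :: ('g::{finite,ab_group_add}) gop)"
proof -
  have A: "commutes N (Astar N s) (Ham N V' :: 'g gop)" for s V'
    unfolding Ham_def using plaqs_of_subset assms
    by (intro commutes_diff commutes_uminus commutes_sum commutes_Astar commutes_Astar_Bplaq) auto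
  have B: "commutes N (Bplaq N p) (Ham N V' :: 'g gop)" if "p \<in> vertices N" for p V'
    unfolding Ham_def using plaqs_of_subset assms that
    by (intro commutes_diff commutes_uminus commutes_sum commutes_Bplaq commutes_sym[OF commutes_Astar_Bplaq]) auto
  have "commutes N (Ham N V') (Ham N V :: 'g gop)"
    unfolding Ham_def[of N V] using plaqs_of_subset
    by (intro commutes_diff commutes_uminus commutes_sum commutes_sym[OF A] commutes_sym[OF B]) auto
  then show ?thesis by (rule commutes_sym)
qed

text \<open>A term that does not touch R is blind at e, hence commutes with everything on e.\<close>

lemma commutes_at_edge_Ham_diff:
  assumes N: "N \<ge> 2" and R: "R \<subseteq> lattice N" and e: "e \<in> R"
  shows "commutes N (at_edge N e X) (Ham N (lattice N) - Ham N R :: ('g::{finite,ab_group_add}) gop)"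
proof -
  have el: "e \<in> lattice N" using R e by blast
  have "commutes N (at_edge N e X) (Astar N s :: 'g gop)" if "s \<in> vertices N - stars_of N R" for s
  proof (rule commutes_sym, rule blind_commutes[OF el Astar_ops], rule blind_Astar[OF el])
    show "e \<notin> dstar N s" using that e by (auto simp: stars_of_def)
  qed
  moreover have "commutes N (at_edge N e X) (Bplaq N p :: 'g gop)" if "p \<in> vertices N - plaqs_of N R" for p
  proof (rule commutes_sym, rule blind_commutes[OF el Bplaq_ops[OF N]])
    show "blind N e (Bplaq N p :: 'g gop)"
      using that e by (intro blind_Bplaq[OF N _ el]) (auto simp: plaqs_of_def)
  qed (use that in auto)
  ultimately show ?thesis
    unfolding Ham_lattice_diff by (intro commutes_diff commutes_uminus commutes_sum)
qed

section \<open>The kernel of the Davies generator\<close>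

text \<open>Vanishing power moments extend to all polynomials, and the polynomial whose zeros are
  the other points of B isolates the value at x.\<close>

lemma vanishing_moments:
  fixes f :: "real \<Rightarrow> complex"
  assumes B: "finite B" and mom: "\<And>k. (\<Sum>x\<in>B. of_real (x ^ k) * f x) = 0" and x: "x \<in> B"
  shows "f x = 0"
proof -
  have poly: "(\<Sum>x\<in>B. poly p (of_real x) * f x) = 0" for p
  proof -
    have "(\<Sum>x\<in>B. poly p (of_real x) * f x) = (\<Sum>x\<in>B. \<Sum>i\<le>degree p. coeff p i * (of_real (x ^ i) * f x))"
      by (simp add: poly_altdef sum_distrib_right mult.assoc)
    also have "\<dots> = (\<Sum>i\<le>degree p. coeff p i * (\<Sum>x\<in>B. of_real (x ^ i) * f x))"
      by (subst sum.swap) (simp add: sum_distrib_left)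
    finally show ?thesis by (simp only: mom) simp
  qed
  define p where "p = (\<Prod>y\<in>B - {x}. [:- of_real y, 1 :: complex:])"
  have p: "poly p (of_real z) = (\<Prod>y\<in>B - {x}. of_real (z - y))" for z
    by (simp add: p_def poly_prod)
  have "(\<Sum>z\<in>B. poly p (of_real z) * f z) = (\<Sum>z\<in>{x}. poly p (of_real z) * f z)"
  proof (rule sum.mono_neutral_right[OF B])
    show "\<forall>z\<in>B - {x}. poly p (of_real z) * f z = 0"
      using B by (auto simp: p intro!: prod_zero)
  qed (use x in simp)
  moreover have "poly p (of_real x) \<noteq> 0" using B by (simp add: p)
  ultimately show ?thesis using poly[of p] by simp
qed

section \<open>Iterated commutators with the Hamiltonian\<close>

definition ad_power :: "nat \<Rightarrow> ('g::zero) gop \<Rightarrow> 'g gop \<Rightarrow> nat \<Rightarrow> 'g gop" where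
  "ad_power N H X k = ((\<lambda>T. mm N H T - mm N T H) ^^ k) X"

lemma ad_power_0: "ad_power N H X 0 = X"
  by (simp add: ad_power_def)

lemma ad_power_Suc: "ad_power N H X (Suc k) = mm N H (ad_power N H X k) - mm N (ad_power N H X k) H"
  by (simp add: ad_power_def)

lemma ad_power_freq:
  fixes H :: "('g::{finite,zero}) gop"
  assumes H: "H \<in> ops N" "adj H = H" and X: "X \<in> ops N"
  shows "ad_power N H X k = (\<Sum>\<omega>\<in>bohr N H. scal (of_real (\<omega> ^ k)) (freq N H X \<omega>))"
proof -
  define P where "P k \<longleftrightarrow> ad_power N H X k = (\<Sum>\<omega>\<in>bohr N H. scal (of_real (\<omega> ^ k)) (freq N H X \<omega>))" for k
  have "P k"
  proof (induction k)
    case 0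
    show ?case by (simp add: P_def ad_power_0 sum_freq[OF H X])
  next
    case (Suc k)
    have "mm N H (scal (of_real (\<omega> ^ k)) (freq N H X \<omega>)) - mm N (scal (of_real (\<omega> ^ k)) (freq N H X \<omega>)) H
        = scal (of_real (\<omega> ^ Suc k)) (freq N H X \<omega>)" for \<omega>
      by (simp add: mm_scal_left mm_scal_right scal_diff[symmetric] commutator_freq[OF H] mult.commute)
    then show ?case
      using Suc unfolding P_def by (simp only: ad_power_Suc mm_sum_left mm_sum_right sum_subtractf[symmetric])
  qed
  then show ?thesis by (simp add: P_def)
qed

text \<open>Each matrix entry of [Q, X(\<omega>)], as a function of \<omega>, has as its moments the
  entries of the commutators of Q with \<open>ad_power\<close>, which vanish.\<close>

lemma commutes_freq_if_commutes_ad_power: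
  fixes H :: "('g::{finite,zero}) gop"
  assumes H: "H \<in> ops N" "adj H = H" and X: "X \<in> ops N"
    and comm: "\<And>k. commutes N Q (ad_power N H X k)" and \<omega>: "\<omega> \<in> bohr N H"
  shows "commutes N Q (freq N H X \<omega>)"
proof -
  define K where "K \<omega> = mm N Q (freq N H X \<omega>) - mm N (freq N H X \<omega>) Q" for \<omega>
  have "(\<Sum>\<omega>\<in>bohr N H. of_real (\<omega> ^ k) * K \<omega> c c') = 0" for k c c'
  proof -
    have "(\<Sum>\<omega>\<in>bohr N H. scal (of_real (\<omega> ^ k)) (K \<omega>)) =
       mm N Q (ad_power N H X k) - mm N (ad_power N H X k) Q"
      unfolding ad_power_freq[OF H X] K_def
      by (simp only: mm_sum_left mm_sum_right mm_scal_left mm_scal_right scal_diff sum_subtractf)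
    also have "\<dots> = 0" using comm[of k] by (simp add: commutes_def)
    finally have "(\<Sum>\<omega>\<in>bohr N H. scal (of_real (\<omega> ^ k)) (K \<omega>)) c c' = 0" by simp
    then show ?thesis by (simp add: sum_gop_apply scal_def)
  qed
  from vanishing_moments[OF finite_bohr[OF H] this \<omega>] have "K \<omega> = 0" by (intro ext) simp
  then show ?thesis by (simp add: K_def commutes_def)
qed

text \<open>The two claims need a joint induction: as long as the iterated commutator commutes with
  H2, the next one can be formed with H1 alone, and H1 commutes with both Q and H2.\<close>

lemma commutes_ad_power_local:
  assumes Q: "commutes N Q X" "commutes N Q H1"
    and X: "commutes N H2 X" and H: "commutes N H2 H1" "H = H1 + H2"
  shows "commutes N Q (ad_power N H X k) \<and> commutes N H2 (ad_power N H X k)"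
proof (induction k)
  case 0
  show ?case using Q X by (simp add: ad_power_0)
next
  case (Suc k)
  let ?T = "ad_power N H X k"
  have "ad_power N H X (Suc k) = mm N H1 ?T - mm N ?T H1"
  proof -
    have "mm N H ?T = mm N H1 ?T + mm N H2 ?T" "mm N ?T H = mm N ?T H1 + mm N ?T H2"
      by (simp_all only: H(2) mm_add_left mm_add_right)
    then show ?thesis using Suc by (simp add: ad_power_Suc commutes_def)
  qed
  moreover have "commutes N Q (mm N H1 ?T - mm N ?T H1)" "commutes N H2 (mm N H1 ?T - mm N ?T H1)"
    using Suc Q H(1) by (auto intro!: commutes_diff commutes_mm)
  ultimately show ?case by metis
qed

text \<open>The Jacobi identity: if [Q,X] = 0, then [[Q,H],X] = [Q,[H,X]].\<close>

lemma commutes_commutator: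
  assumes "commutes N Q X" "commutes N Q (mm N H X - mm N X H)"
  shows "commutes N (mm N Q H - mm N H Q) X"
proof -
  have QX: "mm N Q (mm N X Z) = mm N X (mm N Q Z)" for Z
    using assms(1) by (simp add: commutes_def mm_assoc[symmetric])
  show ?thesis
    using assms unfolding commutes_def
    by (simp add: mm_diff_left mm_diff_right mm_assoc QX algebra_simps)
qed

lemma davies_kernel_iff:
  fixes S :: "edge \<Rightarrow> 'i::finite \<Rightarrow> ('g::{finite,ab_group_add}) sop"
  assumes N: "N \<ge> 2" and R: "R \<subseteq> lattice N"
    and jump_adj: "\<forall>e\<in>lattice N. \<forall>i. \<exists>j. S e j = sadj (S e i)"
    and rates_pos: "\<forall>e i \<omega>. h e i \<omega> > 0"
    and Q: "Q \<in> ops N"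
  defines "H \<equiv> Ham N (lattice N)"
  shows "davies N S h R Q = 0 \<longleftrightarrow>
    (\<forall>e\<in>R. \<forall>i. \<forall>\<omega>\<in>bohr N H. commutes N Q (freq N H (at_edge N e (S e i)) \<omega>))"
proof -
  have H: "H \<in> ops N" "adj H = H" unfolding H_def using Ham_ops[OF N] adj_Ham[OF N] by auto
  define A where "A = R \<times> (UNIV :: 'i set) \<times> bohr N H"
  define J where "J = (\<lambda>(e, i, \<omega>). freq N H (at_edge N e (S e i)) \<omega>)"
  define w where "w = (\<lambda>(e, i, \<omega>). h e i \<omega>)"
  have "davies N S h R Q = (\<Sum>e\<in>R. \<Sum>i\<in>UNIV. \<Sum>\<omega>\<in>bohr N H. lindblad N (w (e, i, \<omega>)) (J (e, i, \<omega>)) Q)"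
    by (simp add: davies_def dissip_def lindblad_def Let_def H_def J_def w_def)
  also have "\<dots> = (\<Sum>a\<in>A. lindblad N (w a) (J a) Q)"
    by (simp add: A_def sum.cartesian_product case_prod_unfold)
  finally have dav: "davies N S h R Q = (\<Sum>a\<in>A. lindblad N (w a) (J a) Q)" .
  have "(\<Sum>a\<in>A. lindblad N (w a) (J a) Q) = 0 \<longleftrightarrow> (\<forall>a\<in>A. commutes N Q (J a))"
  proof (rule lindblad_kernel[OF _ _ _ _ Q])
    show "finite A"
      unfolding A_def using finite_subset[OF R finite_lattice] finite_bohr[OF H] by auto
    fix a assume a: "a \<in> A"
    obtain e i \<omega> where ei: "a = (e, i, \<omega>)" by (cases a)
    show "J a \<in> ops N" unfolding ei J_def by (simp add: freq_ops[OF H at_edge_ops])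
    show "w a > 0" using rates_pos by (simp add: ei w_def)
    have "e \<in> lattice N" using a R by (auto simp: ei A_def)
    then obtain j where "S e j = sadj (S e i)" using jump_adj by blast
    \<comment> \<open>Taking adjoints reverses the frequency, so the partner of a jump carries the
      adjoint operator at the opposite frequency.\<close>
    then have "J (e, j, - \<omega>) = adj (J a)"
      by (simp add: J_def ei adj_freq[OF H] adj_at_edge)
    moreover have "(e, j, - \<omega>) \<in> A" using a by (auto simp: A_def ei uminus_bohr)
    ultimately show "\<exists>b\<in>A. J b = adj (J a)" by blast
  qed
  also have "\<dots> \<longleftrightarrow> (\<forall>e\<in>R. \<forall>i. \<forall>\<omega>\<in>bohr N H. commutes N Q (freq N H (at_edge N e (S e i)) \<omega>))"
    by (auto simp: A_def J_def)
  finally show ?thesis unfolding dav .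
qed

theorem mainTheorem4:
  fixes N :: nat and \<beta> :: real and R :: "edge set"
    and S :: "edge \<Rightarrow> 'i::finite \<Rightarrow> ('g::{finite,ab_group_add}) sop"
    and h :: "edge \<Rightarrow> 'i \<Rightarrow> real \<Rightarrow> real"
  assumes "N \<ge> 2"
    and "\<beta> \<ge> 0"
    and jump_adj: "\<forall>e\<in>lattice N. \<forall>i. \<exists>j. S e j = sadj (S e i)"
    and jump_comm: "\<forall>e\<in>lattice N. \<forall>X :: 'g sop.
           (\<forall>i. smult_site X (S e i) = smult_site (S e i) X) \<longrightarrow> (\<exists>k. X = (\<lambda>a b. k * sid a b))"
    and rates_pos: "\<forall>e i \<omega>. h e i \<omega> > 0"
    and rates_kms: "\<forall>e i \<omega>. h e i (- \<omega>) = h e i \<omega> * exp (- \<beta> * \<omega>)"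
    and "R \<subseteq> lattice N"
    and "star_connected N R"
    and "plaq_connected N R"
    and "card R \<ge> 2"
  shows "{Q \<in> ops N. davies N S h R Q = 0}
       = id_tensor N R \<inter>
         {Q. (\<forall>s\<in>stars_of N R. mm N Q (Astar N s) = mm N (Astar N s) Q) \<and>
             (\<forall>p\<in>plaqs_of N R. mm N Q (Bplaq N p) = mm N (Bplaq N p) Q)}"
proof -
  note N = \<open>N \<ge> 2\<close> and R = \<open>R \<subseteq> lattice N\<close> and card = \<open>card R \<ge> 2\<close>
  have RL: "e \<in> lattice N" if "e \<in> R" for e using that R by blast
  define H where "H = (Ham N (lattice N) :: 'g gop)"
  have H: "H \<in> ops N" "adj H = H" unfolding H_def using Ham_ops[OF N] adj_Ham[OF N] by auto
  have Hsum: "H = - (\<Sum>v\<in>vertices N. Astar N v) - (\<Sum>v\<in>vertices N. Bplaq N v)"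
    by (simp add: H_def Ham_def stars_of_lattice plaqs_of_lattice)
  have Hsum': "H = - (\<Sum>v\<in>vertices N. Bplaq N v) - (\<Sum>v\<in>vertices N. Astar N v)"
    unfolding Hsum by (simp add: algebra_simps)
  note ker = davies_kernel_iff[OF N R jump_adj rates_pos, folded H_def]
  have conn: "\<forall>e\<in>R. \<forall>e'\<in>R. (e, e') \<in> {(e, e'). e \<in> R \<and> e' \<in> R \<and> (\<exists>v\<in>vertices N. e \<in> dstar N v \<and> e' \<in> dstar N v)}\<^sup>*"
    using \<open>star_connected N R\<close> unfolding star_connected_def star_step_def .
  have conn': "\<forall>e\<in>R. \<forall>e'\<in>R. (e, e') \<in> {(e, e'). e \<in> R \<and> e' \<in> R \<and> (\<exists>v\<in>vertices N. e \<in> pbound N v \<and> e' \<in> pbound N v)}\<^sup>*"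
    using \<open>plaq_connected N R\<close> unfolding plaq_connected_def plaq_step_def .
  have "davies N S h R Q = 0 \<longleftrightarrow> (\<forall>e\<in>R. blind N e Q) \<and> (\<forall>s\<in>stars_of N R. commutes N Q (Astar N s)) \<and>
             (\<forall>p\<in>plaqs_of N R. commutes N Q (Bplaq N p))" if Q: "Q \<in> ops N" for Q
  proof
    assume "davies N S h R Q = 0"
    then have comm: "commutes N Q (freq N H (at_edge N e (S e i)) \<omega>)" if "e \<in> R" "\<omega> \<in> bohr N H" for e i \<omega>
      using that by (simp add: ker[OF Q])
    \<comment> \<open>The cases k = 0 and k = 1 are the jump operator itself and its commutator with
      H; they give the next two facts.\<close>
    have adk: "commutes N Q (ad_power N H (at_edge N e (S e i)) k)" if "e \<in> R" for e i k
      unfolding ad_power_freq[OF H at_edge_ops] using that by (intro commutes_sum commutes_scal comm)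
    have QS: "commutes N Q (at_edge N e (S e i))" if "e \<in> R" for e i
      using adk[OF that, of i 0] by (simp add: ad_power_0)
    have KS: "commutes N (mm N Q H - mm N H Q) (at_edge N e (S e i))" if "e \<in> R" for e i
      using adk[OF that, of i "Suc 0"] by (intro commutes_commutator QS that) (simp add: ad_power_Suc ad_power_0)
    \<comment> \<open>The trivial commutant turns commuting with the jump operators into blindness,
      and thereby into commuting with all operators of the edge, in particular projections and
      shifts.\<close>
    have blind: "blind N e Z" if "e \<in> R" "\<And>i. commutes N Z (at_edge N e (S e i))" for e Z
      using RL[OF that(1)] jump_comm that(2) by (intro blind_if_commutes[of e N "S e"]) auto
    have K: "mm N Q H - mm N H Q \<in> ops N" using Q H by (intro ops_diff ops_mm)
    have Qe: "commutes N Q (at_edge N e X)" if "e \<in> R" for e X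
      by (rule blind_commutes[OF RL[OF that] Q blind[OF that QS[OF that]]])
    have Ke: "commutes N (mm N Q H - mm N H Q) (at_edge N e X)" if "e \<in> R" for e X
      by (rule blind_commutes[OF RL[OF that] K blind[OF that KS[OF that]]])
    have "commutes N Q (Astar N s)" if "s \<in> stars_of N R" for s
    \<comment> \<open>The projections |g><g| sum to the identity, so \<kappa> = 1; \<mu> is the
      weight of the identity in a star term.\<close>
    proof (rule commutes_cell_terms[where W = "vertices N" and Z = "Bplaq N" and U = "edge_unit N" and V = "edge_unit N"
          and R = R and D = "dstar N" and D' = "pbound N" and \<kappa> = 1 and \<mu> = "1 / of_nat (card (UNIV :: 'g set))",
          OF finite_vertices Hsum Q H(1)])
      show "commutes N Q (edge_unit N e j)" "commutes N (mm N Q H - mm N H Q) (edge_unit N e j)" if "e \<in> R" for e j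
        unfolding edge_unit_def using Qe[OF that] Ke[OF that] by auto
      then show "commutes N Q (edge_unit N e j)" if "e \<in> R" for e j using that by blast
      show "(\<Sum>j\<in>UNIV. mm N (edge_unit N e j) (edge_unit N e j)) = scal 1 (idop N :: 'g gop)" if "e \<in> R" for e
        using dephase_idop[OF RL[OF that], where ?'a = 'g] by (simp add: twirl_def idop_left at_edge_ops edge_unit_def)
      show "dephase N e (Bplaq N v) = scal 1 (Bplaq N v)" if "e \<in> R" "v \<in> vertices N" for e v
        using dephase_Bplaq[OF N that(2) RL[OF that(1)]] by simp
      show "dephase N e (Astar N v) = scal 1 (Astar N v)" if "e \<in> R" "v \<in> vertices N" "e \<notin> dstar N v" for e v
        using dephase_Astar_off[OF RL[OF that(1)] that(3)] by simp
      show "dephase N e (Astar N v :: 'g gop) = scal (1 / of_nat (card (UNIV :: 'g set))) (idop N)"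
        if "e \<in> R" "v \<in> vertices N" "e \<in> dstar N v" for e v
        by (rule dephase_Astar_on[OF RL[OF that(1)] that(3)])
      show "\<exists>v1 v2. v1 \<noteq> v2 \<and> {v \<in> vertices N. e \<in> dstar N v} = {v1, v2}" if "e \<in> R" for e
        by (rule two_stars_of_edge[OF N RL[OF that]])
      show "{v \<in> vertices N. e \<in> dstar N v} \<noteq> {v \<in> vertices N. e' \<in> dstar N v}"
        if "v \<in> vertices N" "e \<in> pbound N v" "e' \<in> pbound N v" "e \<in> R" "e' \<in> R" "e \<noteq> e'" for e e' v
        by (rule stars_separate_plaq_edges[OF N that(1-3) RL[OF that(4)] RL[OF that(5)] that(6)])
    qed (use that conn conn' card in \<open>auto simp: stars_of_def\<close>)
    moreover have "commutes N Q (Bplaq N p)" if "p \<in> plaqs_of N R" for p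
    \<comment> \<open>Each L^g times its inverse is the identity, so \<kappa> = |G|. Stars and
      plaquettes, and with them the two connectivities, exchange roles.\<close>
    proof (rule commutes_cell_terms[where W = "vertices N" and Z = "Astar N" and U = "edge_shift N"
          and V = "\<lambda>e g. edge_shift N e (- g)"
          and R = R and D = "pbound N" and D' = "dstar N" and \<kappa> = "of_nat (card (UNIV :: 'g set))"
          and \<mu> = "\<Sum>g\<in>UNIV. flux_weight (g :: 'g)",
          OF finite_vertices Hsum' Q H(1)])
      show "commutes N Q (edge_shift N e j)" "commutes N (mm N Q H - mm N H Q) (edge_shift N e j)" if "e \<in> R" for e j
        unfolding edge_shift_def using Qe[OF that] Ke[OF that] by auto
      then show "commutes N Q (edge_shift N e (- j))" if "e \<in> R" for e j using that by blast
      show "(\<Sum>j\<in>UNIV. mm N (edge_shift N e j) (edge_shift N e (- j))) = scal (of_nat (card (UNIV :: 'g set))) (idop N :: 'g gop)" if "e \<in> R" for e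
        using shift_twirl_idop[OF RL[OF that], where ?'g = 'g] by (simp add: twirl_def idop_left at_edge_ops edge_shift_def)
      show "shift_twirl N e (Astar N v) = scal (of_nat (card (UNIV :: 'g set))) (Astar N v :: 'g gop)" if "e \<in> R" "v \<in> vertices N" for e v
        by (rule shift_twirl_Astar[OF RL[OF that(1)]])
      show "shift_twirl N e (Bplaq N v) = scal (of_nat (card (UNIV :: 'g set))) (Bplaq N v :: 'g gop)"
        if "e \<in> R" "v \<in> vertices N" "e \<notin> pbound N v" for e v
        by (rule shift_twirl_Bplaq_off[OF N that(2) RL[OF that(1)] that(3)])
      show "shift_twirl N e (Bplaq N v :: 'g gop) = scal (\<Sum>g\<in>UNIV. flux_weight (g :: 'g)) (idop N)"
        if "e \<in> R" "v \<in> vertices N" "e \<in> pbound N v" for e v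
        by (rule shift_twirl_Bplaq_on[OF N that(2) RL[OF that(1)] that(3)])
      show "\<exists>v1 v2. v1 \<noteq> v2 \<and> {v \<in> vertices N. e \<in> pbound N v} = {v1, v2}" if "e \<in> R" for e
        by (rule two_plaqs_of_edge[OF N RL[OF that]])
      show "{v \<in> vertices N. e \<in> pbound N v} \<noteq> {v \<in> vertices N. e' \<in> pbound N v}"
        if "v \<in> vertices N" "e \<in> dstar N v" "e' \<in> dstar N v" "e \<in> R" "e' \<in> R" "e \<noteq> e'" for e e' v
        by (rule plaqs_separate_star_edges[OF N that(1-3) RL[OF that(4)] RL[OF that(5)] that(6)])
    qed (use that conn conn' card in \<open>auto simp: plaqs_of_def\<close>)
    ultimately show "(\<forall>e\<in>R. blind N e Q) \<and> (\<forall>s\<in>stars_of N R. commutes N Q (Astar N s)) \<and>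
             (\<forall>p\<in>plaqs_of N R. commutes N Q (Bplaq N p))"
      using blind QS by blast
  next
    assume comm: "(\<forall>e\<in>R. blind N e Q) \<and> (\<forall>s\<in>stars_of N R. commutes N Q (Astar N s)) \<and>
             (\<forall>p\<in>plaqs_of N R. commutes N Q (Bplaq N p))"
    have QH: "commutes N Q (Ham N R)"
      unfolding Ham_def using comm by (intro commutes_diff commutes_uminus commutes_sum) auto
    \<comment> \<open>The first part consists of the terms touching R and commutes with Q; the rest
      commutes with the edge operators in R and with the first part.\<close>
    have split: "Ham N R + (H - Ham N R) = H" by simp
    have "commutes N Q (freq N H (at_edge N e (S e i)) \<omega>)" if e: "e \<in> R" and \<omega>: "\<omega> \<in> bohr N H" for e i \<omega>
    proof (rule commutes_freq_if_commutes_ad_power[OF H at_edge_ops _ \<omega>])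
      fix k
      have "commutes N Q (at_edge N e (S e i))"
        using comm e by (intro blind_commutes[OF RL[OF e] Q]) blast
      moreover have "commutes N (H - Ham N R) (at_edge N e (S e i))"
        unfolding H_def by (rule commutes_sym[OF commutes_at_edge_Ham_diff[OF N R e]])
      moreover have "commutes N (H - Ham N R) (Ham N R)"
        unfolding H_def by (rule commutes_sym, intro commutes_diff commutes_Ham[OF N])
      ultimately show "commutes N Q (ad_power N H (at_edge N e (S e i)) k)"
        using commutes_ad_power_local[OF _ QH _ _ split[symmetric], of "at_edge N e (S e i)" k] by blast
    qed
    then show "davies N S h R Q = 0" by (simp add: ker[OF Q])
  qed
  then show ?thesis
    using id_tensor_iff_blind[OF R, where ?'g = 'g] unfolding commutes_def by blast
qed

end
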